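(* Let $(T_t)_{t\ge0}$ be an individually eventually positive $C_0$-semigroup on a (complex) Banach lattice $X$. Then the following assertions are all equivalent: (i) $(T_t)_{t\ge0}$ is Cesàro bounded; (ii) $(T_t)_{t\ge0}$ is strongly Cesàro bounded; (iii) $(T_t)_{t\ge0}$ is uniformly Kreiss bounded; (iv) $(T_t)_{t\ge0}$ is Kreiss bounded; (v) $(T_t)_{t\ge0}$ is Abel bounded.
   Context: A (complex) Banach lattice is the complexification $X=X_{\mathbb{R}}+iX_{\mathbb{R}}$ of a real Banach lattice $X_{\mathbb{R}}$, with positive cone $X_+$. The semigroup $(T_t)_{t\ge0}$ is individually eventually positive if for every $x\in X_+$ there exists $t_x\ge0$ such that $T_tx\in X_+$ for every $t\ge t_x$. Let $-A$ be the generator of the $C_0$-semigroup $(T_t)_{t\ge0}$, let $\mathbb{C}_\pm=\{\lambda\in\mathbb{C}:\pm\operatorname{Re}\lambda>0\}$, let $\rho(A)$ be the resolvent set of $A$ and $R(\mu,A)=(\mu-A)^{-1}$ for $\mu\in\rho(A)$. In each definition below, $C$ denotes a constant depending only on the semigroup. The semigroup $(T_t)_{t\ge0}$ is: - Kreiss bounded if $\mathbb{C}_-\subseteq\rho(A)$ and $\|R(-\lambda,A)\|\le \frac{C}{\operatorname{Re}(\lambda)}$ for every $\lambda\in\mathbb{C}_+$; - Abel bounded if $(-\infty,0)\subseteq\rho(A)$ and $\|R(-\mu,A)\|\le\frac{C}{\mu}$ for every $\mu>0$; - uniformly Kreiss bounded if $\left\|\int_0^t e^{i\beta s}e^{-\alpha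 s}T_sx\,ds\right\|\le\frac{C\|x\|}{\alpha}$ for every $\alpha>0$, $\beta\in\mathbb{R}$, $t>0$ and $x\in X$; - Cesàro bounded if $\frac1t\left\|\int_0^tT_sx\,ds\right\|\le C\|x\|$ for every $x\in X$ and $t>0$; - strongly Cesàro bounded if $\frac1t\int_0^t|\langle T_sx,x^*\rangle|\,ds\le C\|x\|\,\|x^*\|$ for every $x\in X$, $x^*\in X^*$ and $t>0$. *)

theory Defs
  imports "HOL-Analysis.Analysis" "HOL-Library.Lattice_Algebras"
begin

section \<open>Real Banach lattices\<close>

class banach_lattice = banach + lattice_ab_group_add_abs + ordered_real_vector +
  assumes norm_lattice_mono: "\<bar>x\<bar> \<le> \<bar>y\<bar> \<Longrightarrow> norm x \<le> norm y"

instance real :: banach_lattice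
  by standard (auto simp: abs_real_def sup_real_def max_def)

lemma norm_abs_lattice [simp]: "norm \<bar>x\<bar> = norm x" for x :: "'a::banach_lattice"
  by (intro antisym norm_lattice_mono) simp_all

lemma norm_mono_nonneg: "0 \<le> x \<Longrightarrow> x \<le> y \<Longrightarrow> norm x \<le> norm y" for x :: "'a::banach_lattice"
  by (rule norm_lattice_mono) simp

lemma abs_scaleR_le: "\<bar>a *\<^sub>R x\<bar> \<le> \<bar>a\<bar> *\<^sub>R \<bar>x\<bar>" for x :: "'a::banach_lattice"
proof (rule abs_leI)
  have x: "x \<le> \<bar>x\<bar>" "- x \<le> \<bar>x\<bar>"
    by (simp_all add: abs_ge_self abs_ge_minus_self)
  have *: "b *\<^sub>R y \<le> \<bar>b\<bar> *\<^sub>R z" if "y \<le> z" "- y \<le> z" for b and y z :: 'a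
  proof (cases "0 \<le> b")
    case True
    then show ?thesis using scaleR_left_mono[OF that(1), of b] by simp
  next
    case False
    then show ?thesis using scaleR_left_mono[OF that(2), of "- b"] by simp
  qed
  show "a *\<^sub>R x \<le> \<bar>a\<bar> *\<^sub>R \<bar>x\<bar>" using *[OF x] .
  show "- (a *\<^sub>R x) \<le> \<bar>a\<bar> *\<^sub>R \<bar>x\<bar>" using *[of "- x" "\<bar>x\<bar>" a] x by simp
qed

lemma tendsto_abs_lattice:
  fixes s :: "'b \<Rightarrow> 'a::banach_lattice"
  assumes "(s \<longlongrightarrow> l) F"
  shows "((\<lambda>n. \<bar>s n\<bar>) \<longlongrightarrow> \<bar>l\<bar>) F"
proof -
  have le: "norm (\<bar>a\<bar> - \<bar>b\<bar>) \<le> norm (a - b)" for a b :: 'a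
  proof (rule norm_lattice_mono)
    show "\<bar>\<bar>a\<bar> - \<bar>b\<bar>\<bar> \<le> \<bar>a - b\<bar>" by (rule abs_triangle_ineq3)
  qed
  have "((\<lambda>n. s n - l) \<longlongrightarrow> 0) F" using assms by (rule Lim_null[THEN iffD1])
  then have "((\<lambda>n. norm (s n - l)) \<longlongrightarrow> 0) F" by (rule tendsto_norm_zero)
  moreover have "\<forall>\<^sub>F n in F. norm (\<bar>s n\<bar> - \<bar>l\<bar>) \<le> norm (s n - l)" by (simp add: le)
  ultimately have "((\<lambda>n. \<bar>s n\<bar> - \<bar>l\<bar>) \<longlongrightarrow> 0) F" by (rule Lim_null_comparison[rotated])
  then show ?thesis by (rule Lim_null[THEN iffD2])
qed

lemma tendsto_nonneg_lattice:
  fixes s :: "nat \<Rightarrow> 'a::banach_lattice"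
  assumes "s \<longlonglongrightarrow> l" "\<And>n. 0 \<le> s n"
  shows "0 \<le> l"
proof -
  have "s \<longlonglongrightarrow> \<bar>l\<bar>" using tendsto_abs_lattice[OF assms(1)] assms(2) by simp
  then have "l = \<bar>l\<bar>" using assms(1) LIMSEQ_unique by blast
  then show ?thesis by (metis abs_ge_zero)
qed

lemma tendsto_le_lattice:
  fixes s t :: "nat \<Rightarrow> 'a::banach_lattice"
  assumes "s \<longlonglongrightarrow> l" "t \<longlonglongrightarrow> m" "\<And>n. s n \<le> t n"
  shows "l \<le> m"
  using tendsto_nonneg_lattice[OF tendsto_diff[OF assms(2,1)]] assms(3) by simp


section \<open>The complexification of a Banach lattice\<close>

text \<open>\<open>Cplx x y\<close> stands for \<open>x + iy\<close>. The modulus is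
  \<open>|x + iy| = sup {cos \<theta> x + sin \<theta> y | \<theta>}\<close>, and the norm of \<open>x + iy\<close> is the norm of its modulus.\<close>

datatype 'a complexification = Cplx (re_part: 'a) (im_part: 'a)

definition is_modulus :: "'a::banach_lattice complexification \<Rightarrow> 'a \<Rightarrow> bool" where
  "is_modulus z s \<longleftrightarrow>
     (\<forall>\<theta>. cos \<theta> *\<^sub>R re_part z + sin \<theta> *\<^sub>R im_part z \<le> s) \<and>
     (\<forall>w. (\<forall>\<theta>. cos \<theta> *\<^sub>R re_part z + sin \<theta> *\<^sub>R im_part z \<le> w) \<longrightarrow> s \<le> w)"

definition modulus :: "'a::banach_lattice complexification \<Rightarrow> 'a" where
  "modulus z = (THE s. is_modulus z s)"

lemma rotation_lipschitz:
  fixes x y :: "'a::banach_lattice"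
  shows "cos a *\<^sub>R x + sin a *\<^sub>R y \<le> cos b *\<^sub>R x + sin b *\<^sub>R y + \<bar>a - b\<bar> *\<^sub>R (\<bar>x\<bar> + \<bar>y\<bar>)"
proof -
  have c: "\<bar>cos a - cos b\<bar> \<le> \<bar>a - b\<bar>"
  proof -
    have "norm (cos a - cos b) \<le> 1 * norm (a - b)"
      by (rule field_differentiable_bound[of UNIV cos "\<lambda>x. - sin x"])
         (auto intro!: derivative_eq_intros)
    then show ?thesis by simp
  qed
  have s: "\<bar>sin a - sin b\<bar> \<le> \<bar>a - b\<bar>"
  proof -
    have "norm (sin a - sin b) \<le> 1 * norm (a - b)"
      by (rule field_differentiable_bound[of UNIV sin cos])
         (auto intro!: derivative_eq_intros)
    then show ?thesis by simp
  qed
  have *: "d *\<^sub>R v \<le> e *\<^sub>R \<bar>v\<bar>" if "\<bar>d\<bar> \<le> e" for d e and v :: 'a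
  proof -
    have "d *\<^sub>R v \<le> \<bar>d *\<^sub>R v\<bar>" by (rule abs_ge_self)
    also have "\<dots> \<le> \<bar>d\<bar> *\<^sub>R \<bar>v\<bar>" by (rule abs_scaleR_le)
    also have "\<dots> \<le> e *\<^sub>R \<bar>v\<bar>" using that by (rule scaleR_right_mono) simp
    finally show ?thesis .
  qed
  have "(cos a - cos b) *\<^sub>R x + (sin a - sin b) *\<^sub>R y \<le> \<bar>a - b\<bar> *\<^sub>R \<bar>x\<bar> + \<bar>a - b\<bar> *\<^sub>R \<bar>y\<bar>"
    by (intro add_mono * c s)
  then show ?thesis by (simp add: algebra_simps)
qed

lemma is_modulus_ex: "\<exists>s. is_modulus z s"
proof -
  define x y where "x = re_part z" and "y = im_part z"
  define u where "u = \<bar>x\<bar> + \<bar>y\<bar>"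
  define f where "f \<theta> = cos \<theta> *\<^sub>R x + sin \<theta> *\<^sub>R y" for \<theta>
  define N where "N n = (\<lambda>k. real k / real (Suc n)) ` {..7 * Suc n}" for n
  define s where "s n = Sup_fin (f ` N n)" for n
  define e where "e n = 1 / real (Suc n)" for n
  have N: "finite (f ` N n)" "f ` N n \<noteq> {}" for n
    by (auto simp: N_def)
  have u0: "0 \<le> u" by (simp add: u_def)
  have e0: "0 \<le> e n" for n by (simp add: e_def)
  have elim: "e \<longlonglongrightarrow> 0" unfolding e_def by (rule LIMSEQ_Suc[OF lim_1_over_n])
  have upper: "f \<theta> \<le> s n + e n *\<^sub>R u" for \<theta> n
  proof -
    obtain t where t: "0 \<le> t" "t < 2 * pi" "cos \<theta> = cos t" "sin \<theta> = sin t"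
      by (rule sincos_total_2pi[of "cos \<theta>" "sin \<theta>"]) simp_all
    define k where "k = nat \<lfloor>t * real (Suc n)\<rfloor>"
    have k: "real k \<le> t * real (Suc n)" "t * real (Suc n) < real k + 1"
      using t(1) by (auto simp: k_def)
    have "t \<le> 7" using t(2) pi_less_4 pi_approx by simp
    then have "t * real (Suc n) \<le> 7 * real (Suc n)" by (rule mult_right_mono) simp
    with k(1) have "real k \<le> real (7 * Suc n)" by (simp only: of_nat_mult of_nat_numeral)
    then have kle: "k \<le> 7 * Suc n" by (simp only: of_nat_le_iff)
    then have mem: "f (real k / real (Suc n)) \<in> f ` N n" by (auto simp: N_def)
    have "\<bar>t - real k / real (Suc n)\<bar> \<le> e n"
    proof -
      have "t - real k / real (Suc n) = (t * real (Suc n) - real k) / real (Suc n)"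
        by (simp add: diff_divide_distrib)
      moreover have "\<bar>t * real (Suc n) - real k\<bar> \<le> 1" using k by linarith
      ultimately show ?thesis by (simp only: e_def abs_divide abs_of_nat divide_right_mono of_nat_0_le_iff)
    qed
    then have "\<bar>t - real k / real (Suc n)\<bar> *\<^sub>R u \<le> e n *\<^sub>R u"
      using u0 by (rule scaleR_right_mono)
    moreover have "f \<theta> = f t" by (simp add: f_def t)
    moreover have "f t \<le> f (real k / real (Suc n)) + \<bar>t - real k / real (Suc n)\<bar> *\<^sub>R u"
      unfolding f_def u_def by (rule rotation_lipschitz)
    moreover have "f (real k / real (Suc n)) \<le> s n"
      unfolding s_def using N(1) mem by (rule Sup_fin.coboundedI)
    ultimately show ?thesis by (metis add_mono order_trans)
  qed
  have least: "s n \<le> w" if "\<And>\<theta>. f \<theta> \<le> w" for n w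
    unfolding s_def using N that by (intro Sup_fin.boundedI) auto
  have diff: "norm (s m - s n) \<le> (e m + e n) * norm u" for m n
  proof -
    have *: "s m - s n \<le> (e m + e n) *\<^sub>R u" for m n
    proof -
      have "s m \<le> s n + e n *\<^sub>R u" using upper by (rule least)
      then have "s m - s n \<le> e n *\<^sub>R u" by (simp add: algebra_simps)
      also have "\<dots> \<le> (e m + e n) *\<^sub>R u" using u0 e0[of m] by (intro scaleR_right_mono) auto
      finally show ?thesis .
    qed
    have p: "0 \<le> (e m + e n) *\<^sub>R u" using u0 e0[of m] e0[of n] by (intro scaleR_nonneg_nonneg add_nonneg_nonneg)
    have "- (s m - s n) \<le> (e m + e n) *\<^sub>R u" using *[of n m] by (simp add: add.commute)
    with * have "\<bar>s m - s n\<bar> \<le> (e m + e n) *\<^sub>R u" by (rule abs_leI)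
    then have "\<bar>s m - s n\<bar> \<le> \<bar>(e m + e n) *\<^sub>R u\<bar>" using p by simp
    then have "norm (s m - s n) \<le> norm ((e m + e n) *\<^sub>R u)" by (rule norm_lattice_mono)
    then show ?thesis using e0[of m] e0[of n] by simp
  qed
  have "Cauchy s"
  proof (rule CauchyI)
    fix r :: real assume r: "0 < r"
    have "(\<lambda>n. 2 * norm u * e n) \<longlonglongrightarrow> 0" using tendsto_mult_right_zero[OF elim] .
    then have "\<forall>\<^sub>F n in sequentially. 2 * norm u * e n < r" using r by (rule order_tendstoD)
    then obtain M where M: "2 * norm u * e M < r" by (auto simp: eventually_sequentially)
    have "norm (s m - s n) < r" if "m \<ge> M" "n \<ge> M" for m n
    proof -
      have "e m \<le> e M" "e n \<le> e M" using that by (auto simp: e_def frac_le)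
      then have "(e m + e n) * norm u \<le> (e M + e M) * norm u" by (intro mult_right_mono) auto
      with diff[of m n] M show ?thesis by (simp add: algebra_simps)
    qed
    then show "\<exists>M. \<forall>m\<ge>M. \<forall>n\<ge>M. norm (s m - s n) < r" by blast
  qed
  then obtain l where l: "s \<longlonglongrightarrow> l" using Cauchy_convergent convergent_def by blast
  have l': "(\<lambda>n. s n + e n *\<^sub>R u) \<longlonglongrightarrow> l"
    using tendsto_add[OF l tendsto_scaleR[OF elim tendsto_const[of u]]] by simp
  have "f \<theta> \<le> l" for \<theta>
    using tendsto_const l' upper by (rule tendsto_le_lattice)
  moreover have "l \<le> w" if "\<And>\<theta>. f \<theta> \<le> w" for w
    using l tendsto_const least[OF that] by (rule tendsto_le_lattice)
  ultimately have "is_modulus z l"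
    unfolding is_modulus_def f_def x_def y_def by blast
  then show ?thesis by blast
qed

lemma is_modulus_unique: "is_modulus z s \<Longrightarrow> is_modulus z t \<Longrightarrow> s = t"
  unfolding is_modulus_def by (meson order.antisym)

lemma is_modulus_modulus: "is_modulus z (modulus z)"
  unfolding modulus_def using is_modulus_ex is_modulus_unique by (rule ex_ex1I[THEN theI'])

lemma modulus_upper: "cos \<theta> *\<^sub>R re_part z + sin \<theta> *\<^sub>R im_part z \<le> modulus z"
  using is_modulus_modulus[of z] unfolding is_modulus_def by blast

lemma modulus_least:
  "(\<And>\<theta>. cos \<theta> *\<^sub>R re_part z + sin \<theta> *\<^sub>R im_part z \<le> w) \<Longrightarrow> modulus z \<le> w"
  using is_modulus_modulus[of z] unfolding is_modulus_def by blast

lemma abs_re_le_modulus: "\<bar>re_part z\<bar> \<le> modulus z"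
  using modulus_upper[of 0 z] modulus_upper[of pi z] by (auto intro: abs_leI)

lemma abs_im_le_modulus: "\<bar>im_part z\<bar> \<le> modulus z"
  using modulus_upper[of "pi/2" z] modulus_upper[of "- (pi/2)" z] by (auto intro: abs_leI)

lemma modulus_nonneg: "0 \<le> modulus z"
  using abs_re_le_modulus[of z] abs_ge_zero order_trans by blast

lemma modulus_le: "modulus z \<le> \<bar>re_part z\<bar> + \<bar>im_part z\<bar>"
proof (rule modulus_least)
  fix \<theta>
  have *: "d *\<^sub>R v \<le> \<bar>v\<bar>" if "\<bar>d\<bar> \<le> 1" for d :: real and v :: 'a
  proof -
    have "d *\<^sub>R v \<le> \<bar>d *\<^sub>R v\<bar>" by (rule abs_ge_self)
    also have "\<dots> \<le> \<bar>d\<bar> *\<^sub>R \<bar>v\<bar>" by (rule abs_scaleR_le)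
    also have "\<dots> \<le> 1 *\<^sub>R \<bar>v\<bar>" using that by (rule scaleR_right_mono) simp
    finally show ?thesis by simp
  qed
  show "cos \<theta> *\<^sub>R re_part z + sin \<theta> *\<^sub>R im_part z \<le> \<bar>re_part z\<bar> + \<bar>im_part z\<bar>"
    by (intro add_mono *) auto
qed

definition scaleC :: "complex \<Rightarrow> 'a::real_vector complexification \<Rightarrow> 'a complexification"
    (infixr "*\<^sub>C" 75) where
  "c *\<^sub>C z = Cplx (Re c *\<^sub>R re_part z - Im c *\<^sub>R im_part z) (Re c *\<^sub>R im_part z + Im c *\<^sub>R re_part z)"

instantiation complexification :: (real_vector) real_vector
begin

definition "0 = Cplx 0 (0::'a)"
definition "z + w = Cplx (re_part z + re_part w) (im_part z + im_part w :: 'a)"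
definition "z - w = Cplx (re_part z - re_part w) (im_part z - im_part w :: 'a)"
definition "- z = Cplx (- re_part z) (- im_part z :: 'a)"
definition "a *\<^sub>R z = Cplx (a *\<^sub>R re_part z) (a *\<^sub>R im_part z :: 'a)"

lemmas complexification_simps =
  zero_complexification_def plus_complexification_def minus_complexification_def
  uminus_complexification_def scaleR_complexification_def

instance
  by standard (simp_all add: complexification_simps algebra_simps)

end

instantiation complexification :: (banach_lattice) real_normed_vector
begin

definition norm_complexification_def: "norm z = norm (modulus z :: 'a)"
definition "sgn z = z /\<^sub>R norm (z :: 'a complexification)"
definition "dist z w = norm (z - w :: 'a complexification)"
definition "uniformity =
  (INF e\<in>{0<..}. principal {(z :: 'a complexification, w). dist z w < e})"
definition "open (U :: 'a complexification set) \<longleftrightarrow>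
  (\<forall>x\<in>U. \<forall>\<^sub>F (x', y) in uniformity. x' = x \<longrightarrow> y \<in> U)"

lemma norm_re_le: "norm (re_part z) \<le> norm z" for z :: "'a complexification"
  unfolding norm_complexification_def
  using abs_re_le_modulus[of z] modulus_nonneg[of z] by (intro norm_lattice_mono) simp

lemma norm_im_le: "norm (im_part z) \<le> norm z" for z :: "'a complexification"
  unfolding norm_complexification_def
  using abs_im_le_modulus[of z] modulus_nonneg[of z] by (intro norm_lattice_mono) simp

lemma norm_complexification_le: "norm z \<le> norm (re_part z) + norm (im_part z)"
  for z :: "'a complexification"
proof -
  have "norm z \<le> norm (\<bar>re_part z\<bar> + \<bar>im_part z\<bar>)"
    unfolding norm_complexification_def by (intro norm_mono_nonneg modulus_nonneg modulus_le)
  also have "\<dots> \<le> norm \<bar>re_part z\<bar> + norm \<bar>im_part z\<bar>" by (rule norm_triangle_ineq)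
  finally show ?thesis by simp
qed

lemma modulus_add: "modulus (z + w) \<le> modulus z + modulus w" for z w :: "'a complexification"
proof (rule modulus_least)
  fix \<theta>
  show "cos \<theta> *\<^sub>R re_part (z + w) + sin \<theta> *\<^sub>R im_part (z + w) \<le> modulus z + modulus w"
    using add_mono[OF modulus_upper[of \<theta> z] modulus_upper[of \<theta> w]]
    by (simp add: plus_complexification_def algebra_simps)
qed

lemma modulus_scaleC_le: "modulus (c *\<^sub>C z) \<le> cmod c *\<^sub>R modulus z" for z :: "'a complexification"
proof (rule modulus_least)
  fix \<theta>
  have c: "Re c = cmod c * cos (Arg c)" "Im c = cmod c * sin (Arg c)"
    using rcis_cmod_Arg[of c] by (metis Re_rcis, metis Im_rcis)
  have "cos \<theta> *\<^sub>R re_part (c *\<^sub>C z) + sin \<theta> *\<^sub>R im_part (c *\<^sub>C z) =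
      (cos \<theta> * Re c + sin \<theta> * Im c) *\<^sub>R re_part z + (sin \<theta> * Re c - cos \<theta> * Im c) *\<^sub>R im_part z"
    by (simp add: scaleC_def algebra_simps)
  also have "\<dots> =
      cmod c *\<^sub>R (cos (\<theta> - Arg c) *\<^sub>R re_part z + sin (\<theta> - Arg c) *\<^sub>R im_part z)"
    unfolding c cos_diff sin_diff by (simp add: algebra_simps)
  also have "\<dots> \<le> cmod c *\<^sub>R modulus z"
    using modulus_upper by (rule scaleR_left_mono) simp
  finally show "cos \<theta> *\<^sub>R re_part (c *\<^sub>C z) + sin \<theta> *\<^sub>R im_part (c *\<^sub>C z) \<le> cmod c *\<^sub>R modulus z" .
qed

lemma norm_scaleC_le: "norm (c *\<^sub>C z) \<le> cmod c * norm z" for z :: "'a complexification"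
proof -
  have "norm (modulus (c *\<^sub>C z)) \<le> norm (cmod c *\<^sub>R modulus z)"
    using modulus_nonneg modulus_scaleC_le by (rule norm_mono_nonneg)
  then show ?thesis by (simp add: norm_complexification_def)
qed

lemma norm_scaleC: "norm (c *\<^sub>C z) = cmod c * norm z" for z :: "'a complexification"
proof (cases "c = 0")
  case True
  have "norm (c *\<^sub>C z) \<le> 0" using norm_scaleC_le[of c z] True by simp
  moreover have "0 \<le> norm (c *\<^sub>C z)" by (simp add: norm_complexification_def)
  ultimately show ?thesis using True by simp
next
  case False
  have "z = inverse c *\<^sub>C (c *\<^sub>C z)"
  proof -
    have "inverse c *\<^sub>C (c *\<^sub>C z) = (inverse c * c) *\<^sub>C z"
      by (simp add: scaleC_def algebra_simps)
    also have "\<dots> = z" using False by (simp add: scaleC_def)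
    finally show ?thesis by simp
  qed
  then have "norm z \<le> inverse (cmod c) * norm (c *\<^sub>C z)"
    using norm_scaleC_le[of "inverse c" "c *\<^sub>C z"] by (simp add: norm_inverse)
  then have "cmod c * norm z \<le> norm (c *\<^sub>C z)"
    using False by (simp add: field_simps)
  with norm_scaleC_le[of c z] show ?thesis by simp
qed

lemma scaleC_of_real: "complex_of_real a *\<^sub>C z = a *\<^sub>R z" for z :: "'a complexification"
  by (simp add: scaleC_def scaleR_complexification_def)

instance
proof
  fix x y :: "'a complexification" and a :: real
  show "sgn x = x /\<^sub>R norm x" by (rule sgn_complexification_def)
  show "dist x y = norm (x - y)" by (rule dist_complexification_def)
  show "uniformity = (INF e\<in>{0<..}. principal {(z :: 'a complexification, w). dist z w < e})"
    by (rule uniformity_complexification_def)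
  show "open U \<longleftrightarrow> (\<forall>x\<in>U. \<forall>\<^sub>F (x', y) in uniformity. x' = x \<longrightarrow> y \<in> U)"
    for U :: "'a complexification set"
    by (rule open_complexification_def)
  show "norm x = 0 \<longleftrightarrow> x = 0"
  proof
    assume "norm x = 0"
    then have "re_part x = 0" "im_part x = 0" using norm_re_le[of x] norm_im_le[of x] by auto
    then show "x = 0" by (simp add: zero_complexification_def complexification.expand)
  next
    assume "x = 0"
    then have "norm x \<le> 0"
      using norm_complexification_le[of x] by (simp add: zero_complexification_def)
    then show "norm x = 0" by (simp add: norm_complexification_def)
  qed
  show "norm (x + y) \<le> norm x + norm y"
  proof -
    have "norm (modulus (x + y)) \<le> norm (modulus x + modulus y)"
      using modulus_nonneg modulus_add by (rule norm_mono_nonneg)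
    also have "\<dots> \<le> norm (modulus x) + norm (modulus y)" by (rule norm_triangle_ineq)
    finally show ?thesis by (simp add: norm_complexification_def)
  qed
  show "norm (a *\<^sub>R x) = \<bar>a\<bar> * norm x"
    using norm_scaleC[of "complex_of_real a" x] by (simp add: scaleC_of_real)
qed

end

instance complexification :: (banach_lattice) banach
proof
  fix X :: "nat \<Rightarrow> 'a complexification"
  assume X: "Cauchy X"
  have dist: "dist z w = norm (z - w)" for z w :: "'a complexification"
    by (rule dist_complexification_def)
  have re: "dist (re_part z) (re_part w) \<le> dist z w" for z w :: "'a complexification"
    using norm_re_le[of "z - w"] by (simp add: dist dist_norm minus_complexification_def)
  have im: "dist (im_part z) (im_part w) \<le> dist z w" for z w :: "'a complexification"
    using norm_im_le[of "z - w"] by (simp add: dist dist_norm minus_complexification_def)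
  have "Cauchy (\<lambda>n. re_part (X n))" "Cauchy (\<lambda>n. im_part (X n))"
    using X re im unfolding Cauchy_def by (meson le_less_trans)+
  then obtain p q where p: "(\<lambda>n. re_part (X n)) \<longlonglongrightarrow> p" and q: "(\<lambda>n. im_part (X n)) \<longlonglongrightarrow> q"
    by (meson Cauchy_convergent convergent_def)
  have "(\<lambda>n. dist (re_part (X n)) p + dist (im_part (X n)) q) \<longlonglongrightarrow> 0 + 0"
    using p q by (intro tendsto_add) (simp_all add: tendsto_dist_iff[symmetric])
  then have lim: "(\<lambda>n. dist (re_part (X n)) p + dist (im_part (X n)) q) \<longlonglongrightarrow> 0" by simp
  have le: "dist (X n) (Cplx p q) \<le> dist (re_part (X n)) p + dist (im_part (X n)) q" for n
    using norm_complexification_le[of "X n - Cplx p q"]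
    by (simp add: dist dist_norm minus_complexification_def)
  have "X \<longlonglongrightarrow> Cplx p q"
    unfolding tendsto_iff
  proof (intro allI impI)
    fix e :: real assume "0 < e"
    then have "\<forall>\<^sub>F n in sequentially. dist (re_part (X n)) p + dist (im_part (X n)) q < e"
      using lim by (rule order_tendstoD(2)[rotated])
    then show "\<forall>\<^sub>F n in sequentially. dist (X n) (Cplx p q) < e"
      by eventually_elim (use le in \<open>auto intro: le_less_trans\<close>)
  qed
  then show "convergent X" unfolding convergent_def by blast
qed

definition positive_cone :: "'a::banach_lattice complexification set" where
  "positive_cone = {Cplx x 0 | x. 0 \<le> x}"

definition bounded_clinear ::
    "('a::banach_lattice complexification \<Rightarrow> 'a complexification) \<Rightarrow> bool" where
  "bounded_clinear S \<longleftrightarrow> bounded_linear S \<and> (\<forall>c x. S (c *\<^sub>C x) = c *\<^sub>C S x)"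

text \<open>The norm of a dual element is its operator norm \<^const>\<open>onorm\<close>.\<close>

definition dual_space :: "('a::banach_lattice complexification \<Rightarrow> complex) set" where
  "dual_space = {\<phi>. bounded_linear \<phi> \<and> (\<forall>c x. \<phi> (c *\<^sub>C x) = c * \<phi> x)}"


section \<open>Unbounded operators and semigroups\<close>

text \<open>An unbounded operator is given by its domain \<open>D\<close> and a function \<open>A\<close> that matters only on \<open>D\<close>.\<close>

definition resolvent ::
    "'a::banach_lattice complexification set \<Rightarrow> ('a complexification \<Rightarrow> 'a complexification) \<Rightarrow>
     complex \<Rightarrow> 'a complexification \<Rightarrow> 'a complexification" where
  "resolvent D A \<mu> = inv_into D (\<lambda>x. \<mu> *\<^sub>C x - A x)"

definition resolvent_set ::
    "'a::banach_lattice complexification set \<Rightarrow> ('a complexification \<Rightarrow> 'a complexification) \<Rightarrow>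
     complex set" where
  "resolvent_set D A =
     {\<mu>. bij_betw (\<lambda>x. \<mu> *\<^sub>C x - A x) D UNIV \<and> bounded_clinear (resolvent D A \<mu>)}"

text \<open>Only the values of \<open>T\<close> at nonnegative times are relevant.\<close>

definition C0_semigroup ::
    "(real \<Rightarrow> 'a::banach_lattice complexification \<Rightarrow> 'a complexification) \<Rightarrow> bool" where
  "C0_semigroup T \<longleftrightarrow>
     (\<forall>t\<ge>0. bounded_clinear (T t)) \<and>
     (\<forall>x. T 0 x = x) \<and>
     (\<forall>s\<ge>0. \<forall>t\<ge>0. \<forall>x. T (s + t) x = T s (T t x)) \<and>
     (\<forall>x. ((\<lambda>t. T t x) \<longlongrightarrow> x) (at_right 0))"

definition generator_domain ::
    "(real \<Rightarrow> 'a::banach_lattice complexification \<Rightarrow> 'a complexification) \<Rightarrow>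
     'a complexification set" where
  "generator_domain T = {x. \<exists>y. ((\<lambda>t. (T t x - x) /\<^sub>R t) \<longlongrightarrow> y) (at_right 0)}"

definition generator ::
    "(real \<Rightarrow> 'a::banach_lattice complexification \<Rightarrow> 'a complexification) \<Rightarrow>
     'a complexification \<Rightarrow> 'a complexification" where
  "generator T x = Lim (at_right 0) (\<lambda>t. (T t x - x) /\<^sub>R t)"

text \<open>Sign convention: the operator \<open>A\<close> of a semigroup is the one for which \<open>-A\<close> is the
  generator.\<close>

definition negative_generator ::
    "(real \<Rightarrow> 'a::banach_lattice complexification \<Rightarrow> 'a complexification) \<Rightarrow>
     'a complexification \<Rightarrow> 'a complexification" where
  "negative_generator T x = - generator T x"

abbreviation semigroup_rho ::
    "(real \<Rightarrow> 'a::banach_lattice complexification \<Rightarrow> 'a complexification) \<Rightarrow> complex set" where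
  "semigroup_rho T \<equiv> resolvent_set (generator_domain T) (negative_generator T)"

abbreviation semigroup_R ::
    "(real \<Rightarrow> 'a::banach_lattice complexification \<Rightarrow> 'a complexification) \<Rightarrow> complex \<Rightarrow>
     'a complexification \<Rightarrow> 'a complexification" where
  "semigroup_R T \<equiv> resolvent (generator_domain T) (negative_generator T)"

definition individually_eventually_positive ::
    "(real \<Rightarrow> 'a::banach_lattice complexification \<Rightarrow> 'a complexification) \<Rightarrow> bool" where
  "individually_eventually_positive T \<longleftrightarrow>
     (\<forall>x\<in>positive_cone. \<exists>t\<^sub>x\<ge>0. \<forall>t\<ge>t\<^sub>x. T t x \<in> positive_cone)"

definition kreiss_bounded ::
    "(real \<Rightarrow> 'a::banach_lattice complexification \<Rightarrow> 'a complexification) \<Rightarrow> bool" where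
  "kreiss_bounded T \<longleftrightarrow>
     {\<mu>. Re \<mu> < 0} \<subseteq> semigroup_rho T \<and>
     (\<exists>C. \<forall>\<mu>. Re \<mu> > 0 \<longrightarrow> onorm (semigroup_R T (- \<mu>)) \<le> C / Re \<mu>)"

definition abel_bounded ::
    "(real \<Rightarrow> 'a::banach_lattice complexification \<Rightarrow> 'a complexification) \<Rightarrow> bool" where
  "abel_bounded T \<longleftrightarrow>
     complex_of_real ` {..<0} \<subseteq> semigroup_rho T \<and>
     (\<exists>C. \<forall>\<mu>>0. onorm (semigroup_R T (- complex_of_real \<mu>)) \<le> C / \<mu>)"

definition uniformly_kreiss_bounded ::
    "(real \<Rightarrow> 'a::banach_lattice complexification \<Rightarrow> 'a complexification) \<Rightarrow> bool" where
  "uniformly_kreiss_bounded T \<longleftrightarrow>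
     (\<exists>C. \<forall>\<alpha>>0. \<forall>\<beta>. \<forall>t>0. \<forall>x.
        norm (integral {0..t} (\<lambda>s. exp (\<i> * complex_of_real (\<beta> * s)) *\<^sub>C exp (- \<alpha> * s) *\<^sub>R T s x))
          \<le> C * norm x / \<alpha>)"

definition cesaro_bounded ::
    "(real \<Rightarrow> 'a::banach_lattice complexification \<Rightarrow> 'a complexification) \<Rightarrow> bool" where
  "cesaro_bounded T \<longleftrightarrow>
     (\<exists>C. \<forall>x. \<forall>t>0. (1 / t) * norm (integral {0..t} (\<lambda>s. T s x)) \<le> C * norm x)"

definition strongly_cesaro_bounded ::
    "(real \<Rightarrow> 'a::banach_lattice complexification \<Rightarrow> 'a complexification) \<Rightarrow> bool" where
  "strongly_cesaro_bounded T \<longleftrightarrow>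
     (\<exists>C. \<forall>x. \<forall>\<phi>\<in>dual_space. \<forall>t>0.
        (1 / t) * integral {0..t} (\<lambda>s. cmod (\<phi> (T s x))) \<le> C * norm x * onorm \<phi>)"

end

theory Submission
  imports Defs
begin

text \<open>
  Let \<open>K\<close> be the closed cone of vectors whose whole orbit is positive. Every positive vector is
  moved into \<open>K\<close> by some \<open>T \<tau>\<close>, and all five conditions reduce to the linear growth of
  \<open>\<integral>\<^sub>0\<^sup>t T s y ds\<close> for each \<open>y \<in> K\<close>, with a constant depending on \<open>y\<close>.

  For \<open>y \<in> K\<close> and a functional \<open>\<phi>\<close>, \<open>\<integral>\<^sub>0\<^sup>t |\<phi> (T s y)| ds\<close> is at most
  \<open>\<parallel>\<phi>\<parallel> \<parallel>\<integral>\<^sub>0\<^sup>t T s y ds\<parallel>\<close>; decomposing a vector into four positive ones and applying the uniform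
  boundedness principle to these seminorms gives strong Cesaro boundedness. Norming functionals and
  integration by parts turn that into the Cesaro and uniform Kreiss bounds, and the latter makes the
  Laplace integrals converge on the right half-plane to the resolvent.

  If the semigroup is Abel bounded, \<open>z = (\<mu> + A)\<^sup>-\<^sup>1 y\<close> satisfies
  \<open>\<integral>\<^sub>0\<^sup>t exp (-\<mu> s) T s y ds = z - exp (-\<mu> t) T t z\<close>. Since \<open>(\<mu> + A)\<^sup>-\<^sup>1\<close> preserves \<open>K\<close>, this is at
  most \<open>z\<close>, and \<open>\<mu> = 1/t\<close> bounds \<open>\<integral>\<^sub>0\<^sup>t T s y ds\<close> by \<open>e C t \<parallel>y\<parallel>\<close>.
\<close>

section \<open>Uniform boundedness and norming functionals\<close>

text \<open>Baire category: the closed sublevel sets \<open>F n\<close> cover the space, so one of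
  them contains a ball, and subadditivity carries the bound to the origin. Seminorms replace
  operators because the principle is also applied to integrals of
  \<open>cmod (\<phi> (T s x))\<close>.\<close>

theorem uniform_boundedness_seminorms:
  fixes p :: "'i \<Rightarrow> 'b::banach \<Rightarrow> real"
  assumes cont: "\<And>i. i \<in> I \<Longrightarrow> continuous_on UNIV (p i)"
    and add: "\<And>i x y. i \<in> I \<Longrightarrow> p i (x + y) \<le> p i x + p i y"
    and scale: "\<And>i r x. i \<in> I \<Longrightarrow> p i (r *\<^sub>R x) = \<bar>r\<bar> * p i x"
    and bounded: "\<And>x. \<exists>M. \<forall>i\<in>I. p i x \<le> M"
  shows "\<exists>C. \<forall>i\<in>I. \<forall>x. p i x \<le> C * norm x"
proof -
  define F where "F n = {x. \<forall>i\<in>I. p i x \<le> real n}" for n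
  have closed: "closed (F n)" for n
  proof -
    have "F n = (\<Inter>i\<in>I. {x. p i x \<le> real n})" by (auto simp: F_def)
    moreover have "closed {x. p i x \<le> real n}" if "i \<in> I" for i
      using cont[OF that] by (intro closed_Collect_le) auto
    ultimately show ?thesis by auto
  qed
  have cover: "\<Union>(range F) = UNIV"
  proof -
    have "\<exists>n. x \<in> F n" for x
    proof -
      obtain M where M: "\<And>i. i \<in> I \<Longrightarrow> p i x \<le> M" using bounded by blast
      obtain n where "M \<le> real n" using real_arch_simple by blast
      then show ?thesis using M unfolding F_def by (auto intro: order_trans)
    qed
    then show ?thesis by auto
  qed
  have "\<exists>n. interior (F n) \<noteq> {}"
  proof (rule ccontr)
    assume neg: "\<nexists>n. interior (F n) \<noteq> {}"
    have "Met_TC.mtopology interior_of \<Union>(range F) = {}"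
    proof (rule Met_TC.metric_Baire_category_alt)
      show "Met_TC.mcomplete TYPE('b)" by (simp add: complete_UNIV)
      show "closedin Met_TC.mtopology T \<and> Met_TC.mtopology interior_of T = {}"
        if "T \<in> range F" for T
        using that neg closed by auto
    qed auto
    then show False using cover by simp
  qed
  then obtain n x0 e where e: "e > 0" and ball: "cball x0 e \<subseteq> F n"
    by (metis all_not_in_conv mem_interior_cball)
  have "p i x \<le> (2 * real n / e) * norm x" if i: "i \<in> I" for i x
  proof (cases "x = 0")
    case True
    then show ?thesis using scale[OF i, of 0 0] by simp
  next
    case False
    \<comment> \<open>Stretched to length \<open>e\<close>, the vector is a difference of two points
      of the ball, so \<open>p i v\<close> is at most \<open>2 * n\<close>.\<close>
    define v where "v = (e / norm x) *\<^sub>R x"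
    have nv: "norm v = e" using False e by (simp add: v_def)
    have "x0 + v \<in> F n" "x0 \<in> F n"
      using ball nv e by (auto simp: dist_norm subset_iff)
    then have "p i (x0 + v) \<le> real n" "p i ((-1) *\<^sub>R x0) \<le> real n"
      using i scale[OF i, of "-1" x0] by (auto simp: F_def)
    then have "p i v \<le> 2 * real n"
      using add[OF i, of "x0 + v" "(-1) *\<^sub>R x0"] by simp
    moreover have "p i v = (e / norm x) * p i x"
      using scale[OF i, of "e / norm x" x] e by (simp add: v_def)
    ultimately show ?thesis using e False by (simp add: field_simps)
  qed
  then show ?thesis by blast
qed

text \<open>Functionals are represented by their graphs; domination by the norm makes a subspace of
  \<open>X \<times> \<real>\<close> single-valued, so the maximal element produced by Zorn's lemma needs no gluing argument.\<close>

lemma dominated_graph_extend: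
  fixes M :: "('b::real_normed_vector \<times> real) set"
  assumes sub: "subspace M" and dom: "\<And>x r. (x, r) \<in> M \<Longrightarrow> r \<le> norm x"
  obtains a where "\<And>x r. (x, r) \<in> span (insert (x0, a) M) \<Longrightarrow> r \<le> norm x"
proof -
  have M0: "(0, 0) \<in> M" using subspace_0[OF sub] by (simp add: zero_prod_def)
  \<comment> \<open>A value \<open>a\<close> at \<open>x0\<close> is admissible when it lies above
    every \<open>r - norm (x - x0)\<close> and below every \<open>norm (x + x0) - r\<close>;
    \<open>sep\<close> orders the two families, so the supremum of the first works.\<close>
  define A where "A = {r - norm (x - x0) | x r. (x, r) \<in> M}"
  have sep: "r - norm (x - x0) \<le> norm (x' + x0) - r'" if "(x, r) \<in> M" "(x', r') \<in> M" for x r x' r'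
  proof -
    have "(x + x', r + r') \<in> M" using subspace_add[OF sub that] by simp
    then have "r + r' \<le> norm (x + x')" by (rule dom)
    also have "\<dots> = norm ((x - x0) + (x' + x0))" by (simp add: algebra_simps)
    also have "\<dots> \<le> norm (x - x0) + norm (x' + x0)" by (rule norm_triangle_ineq)
    finally show ?thesis by simp
  qed
  have bdd: "bdd_above A"
    using sep[OF _ M0] by (auto simp: A_def intro!: bdd_aboveI[where M = "norm x0"])
  define a where "a = Sup A"
  have lower: "r - norm (x - x0) \<le> a" if "(x, r) \<in> M" for x r
    unfolding a_def by (rule cSup_upper[OF _ bdd]) (use that in \<open>auto simp: A_def\<close>)
  have upper: "a \<le> norm (x + x0) - r" if "(x, r) \<in> M" for x r
    unfolding a_def
  proof (rule cSup_least)
    show "A \<noteq> {}" using M0 by (auto simp: A_def)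
  qed (use sep[OF _ that] in \<open>auto simp: A_def\<close>)
  show thesis
  proof (rule that[of a])
    fix x r assume "(x, r) \<in> span (insert (x0, a) M)"
    then obtain k where "(x, r) - k *\<^sub>R (x0, a) \<in> span M" by (auto simp: span_insert)
    then have m: "(x - k *\<^sub>R x0, r - k * a) \<in> M"
      unfolding span_eq_iff[THEN iffD2, OF sub] by simp
    \<comment> \<open>Dividing by the modulus of \<open>k\<close> reduces the nonzero cases to
      coefficients 1 and -1, which are \<open>upper\<close> and \<open>lower\<close>.\<close>
    consider "k = 0" | "k > 0" | "k < 0" by linarith
    then show "r \<le> norm x"
    proof cases
      case 1
      then show ?thesis using dom[OF m] by simp
    next
      case 2
      have "(1 / k) *\<^sub>R (x - k *\<^sub>R x0, r - k * a) \<in> M" by (rule subspace_scale[OF sub m])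
      then have "((1 / k) *\<^sub>R x - x0, r / k - a) \<in> M" using 2
        by (simp add: algebra_simps divide_simps)
      from upper[OF this] have "r / k \<le> norm ((1 / k) *\<^sub>R x)" by simp
      then show ?thesis using 2 by (simp add: field_simps)
    next
      case 3
      have "(- 1 / k) *\<^sub>R (x - k *\<^sub>R x0, r - k * a) \<in> M" by (rule subspace_scale[OF sub m])
      then have "((- 1 / k) *\<^sub>R x + x0, a - r / k) \<in> M" using 3
        by (simp add: algebra_simps divide_simps)
      from lower[OF this] have "- r / k \<le> norm ((- 1 / k) *\<^sub>R x)" by simp
      then show ?thesis using 3 by (simp add: field_simps)
    qed
  qed
qed

text \<open>A maximal dominated subspace containing \<open>(y, norm y)\<close> meets every fibre,
  since otherwise \<open>dominated_graph_extend\<close> would enlarge it; it is therefore the graph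
  of the functional sought.\<close>

theorem Hahn_Banach_norming:
  fixes y :: "'b::real_normed_vector"
  obtains f :: "'b \<Rightarrow> real" where "linear f" "\<And>x. f x \<le> norm x" "f y = norm y"
proof -
  define \<A> where "\<A> = {M :: ('b \<times> real) set. subspace M \<and> (y, norm y) \<in> M \<and>
    (\<forall>x r. (x, r) \<in> M \<longrightarrow> r \<le> norm x)}"
  have "\<exists>M\<in>\<A>. \<forall>X\<in>\<A>. M \<subseteq> X \<longrightarrow> X = M"
  proof (rule subset_Zorn_nonempty)
    have "r \<le> norm x" if xr: "(x, r) \<in> span {(y, norm y)}" for x r
    proof -
      obtain k where "x = k *\<^sub>R y" "r = k * norm y"
        using xr by (auto simp: span_singleton)
      then show ?thesis by (simp add: mult_right_mono)
    qed
    then have "span {(y, norm y)} \<in> \<A>" by (auto simp: \<A>_def span_base)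
    then show "\<A> \<noteq> {}" by blast
  next
    fix \<C> assume ne: "\<C> \<noteq> {}" and ch: "subset.chain \<A> \<C>"
    have sub: "subspace X" if "X \<in> \<C>" for X
      using that ch by (auto simp: subset_chain_def \<A>_def)
    have "subspace (\<Union>\<C>)"
    proof (rule subspaceI)
      show "0 \<in> \<Union>\<C>" using ne sub subspace_0 by blast
      show "u + v \<in> \<Union>\<C>" if uv: "u \<in> \<Union>\<C>" "v \<in> \<Union>\<C>" for u v
      proof -
        obtain X Y where XY: "X \<in> \<C>" "u \<in> X" "Y \<in> \<C>" "v \<in> Y" using uv by blast
        then have "X \<subseteq> Y \<or> Y \<subseteq> X" using ch by (auto simp: subset_chain_def)
        then show ?thesis using XY sub subspace_add by (metis UnionI subsetD)
      qed
      show "c *\<^sub>R u \<in> \<Union>\<C>" if "u \<in> \<Union>\<C>" for c u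
        using that sub subspace_scale by blast
    qed
    then show "\<Union>\<C> \<in> \<A>" using ne ch unfolding \<A>_def subset_chain_def by blast
  qed
  then obtain M where M: "M \<in> \<A>" and max: "\<And>X. X \<in> \<A> \<Longrightarrow> M \<subseteq> X \<Longrightarrow> X = M" by blast
  have sub: "subspace M" and y: "(y, norm y) \<in> M" and dom: "\<And>x r. (x, r) \<in> M \<Longrightarrow> r \<le> norm x"
    using M by (auto simp: \<A>_def)
  have ex: "\<exists>r. (x, r) \<in> M" for x
  proof -
    obtain a where a: "\<And>x' r. (x', r) \<in> span (insert (x, a) M) \<Longrightarrow> r \<le> norm x'"
      using dominated_graph_extend[OF sub dom] by blast
    have "M \<subseteq> span (insert (x, a) M)" by (meson span_superset subset_insertI subset_trans)
    then have "span (insert (x, a) M) \<in> \<A>" using a y by (auto simp: \<A>_def)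
    then have "span (insert (x, a) M) = M" using \<open>M \<subseteq> _\<close> by (rule max)
    then show ?thesis using span_base[of "(x, a)" "insert (x, a) M"] by auto
  qed
  \<comment> \<open>The difference of two such pairs is \<open>(0, r - s)\<close>, and domination at
    0, applied to both signs, forces it to vanish.\<close>
  have uniq: "r = s" if "(x, r) \<in> M" "(x, s) \<in> M" for x r s
    using dom[of 0 "r - s"] dom[of 0 "s - r"] subspace_diff[OF sub that] subspace_diff[OF sub that(2,1)]
    by simp
  define f where "f x = (THE r. (x, r) \<in> M)" for x
  have f: "(x, f x) \<in> M" for x
    unfolding f_def using ex[of x] uniq by (metis theI)
  have eq: "f x = r" if "(x, r) \<in> M" for x r using uniq f that by blast
  show thesis
  proof (rule that)
    show "linear f"
    proof (rule linearI)
      show "f (u + v) = f u + f v" for u v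
        using subspace_add[OF sub f f, of u v] by (intro eq) simp
      show "f (c *\<^sub>R u) = c *\<^sub>R f u" for c u
        using subspace_scale[OF sub f, of c u] by (intro eq) simp
    qed
    show "f x \<le> norm x" for x using dom f by blast
    show "f y = norm y" using y by (rule eq)
  qed
qed

text \<open>Riemann sums are combinations of values of \<open>f\<close> with nonnegative weights,
  hence lie in \<open>P\<close>, and the integral is their limit. The general cone serves both
  \<open>positive_cone\<close> and \<open>positive_orbits\<close>.\<close>

lemma integral_closed_convex_cone:
  fixes f :: "real \<Rightarrow> 'b::banach"
  assumes f: "f integrable_on {a..b}" and P: "\<And>s. s \<in> {a..b} \<Longrightarrow> f s \<in> P"
    and "closed P" "0 \<in> P" "\<And>x y. x \<in> P \<Longrightarrow> y \<in> P \<Longrightarrow> x + y \<in> P"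
    and scale: "\<And>r x. 0 \<le> r \<Longrightarrow> x \<in> P \<Longrightarrow> r *\<^sub>R x \<in> P"
  shows "integral {a..b} f \<in> P"
proof (rule Lim_in_closed_set)
  show "((\<lambda>p. \<Sum>(x,k)\<in>p. measure lborel k *\<^sub>R f x) \<longlongrightarrow> integral {a..b} f) (division_filter {a..b})"
    using integrable_integral[OF f] has_integral_cbox[of f _ a b] by simp
  show "\<forall>\<^sub>F p in division_filter {a..b}. (\<Sum>(x,k)\<in>p. measure lborel k *\<^sub>R f x) \<in> P"
    using eventually_division_filter_tagged_division[of "{a..b}"]
  proof eventually_elim
    case (elim p)
    have mem: "measure lborel k *\<^sub>R f x \<in> P" if "(x, k) \<in> p" for x k
      using tag_in_interval[OF elim that] by (intro scale P) auto
    have sum: "sum g Q \<in> P" if "finite Q" "\<And>q. q \<in> Q \<Longrightarrow> g q \<in> P"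
      for g and Q :: "(real \<times> real set) set"
      using that by (induction rule: finite_induct) (simp_all add: assms)
    show ?case
    proof (rule sum)
      show "finite p" using elim by blast
    qed (use mem in auto)
  qed
  show "division_filter {a..b} \<noteq> bot" using division_filter_not_empty[of a b] by simp
qed fact

section \<open>The positive cone of the complexification\<close>

lemma scaleC_scaleC: "a *\<^sub>C b *\<^sub>C z = (a * b) *\<^sub>C z"
  by (simp add: scaleC_def algebra_simps)

lemma scaleC_one [simp]: "1 *\<^sub>C z = z"
  by (simp add: scaleC_def)

lemma scaleC_scaleR: "c *\<^sub>C r *\<^sub>R z = (c * complex_of_real r) *\<^sub>C z"
  by (simp add: scaleC_def scaleR_complexification_def algebra_simps)

lemma scaleR_scaleC: "r *\<^sub>R c *\<^sub>C z = (c * complex_of_real r) *\<^sub>C z"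
  by (simp add: scaleC_def scaleR_complexification_def algebra_simps)

lemma bounded_bilinear_scaleC:
  "bounded_bilinear (scaleC :: complex \<Rightarrow> 'a::banach_lattice complexification \<Rightarrow> _)"
proof
  show "\<exists>K. \<forall>a b. norm (a *\<^sub>C (b :: 'a complexification)) \<le> norm a * norm b * K"
    by (rule exI[of _ 1]) (simp add: norm_scaleC)
qed (simp_all add: scaleC_def complexification_simps algebra_simps)

lemmas bounded_linear_scaleC_right = bounded_bilinear.bounded_linear_right[OF bounded_bilinear_scaleC]

lemma bounded_linear_re_part: "bounded_linear (re_part :: 'a::banach_lattice complexification \<Rightarrow> 'a)"
  by (rule bounded_linear_intro[where K = 1]) (simp_all add: complexification_simps norm_re_le)

lemma bounded_linear_im_part: "bounded_linear (im_part :: 'a::banach_lattice complexification \<Rightarrow> 'a)"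
  by (rule bounded_linear_intro[where K = 1]) (simp_all add: complexification_simps norm_im_le)

lemma positive_cone_iff: "z \<in> positive_cone \<longleftrightarrow> 0 \<le> re_part z \<and> im_part z = 0"
  unfolding positive_cone_def by (cases z) auto

lemma positive_cone_zero: "0 \<in> positive_cone"
  by (simp add: positive_cone_iff zero_complexification_def)

lemma positive_cone_add: "x \<in> positive_cone \<Longrightarrow> y \<in> positive_cone \<Longrightarrow> x + y \<in> positive_cone"
  by (simp add: positive_cone_iff plus_complexification_def)

lemma positive_cone_scaleR: "0 \<le> r \<Longrightarrow> x \<in> positive_cone \<Longrightarrow> r *\<^sub>R x \<in> positive_cone"
  by (simp add: positive_cone_iff scaleR_complexification_def scaleR_nonneg_nonneg)

lemma closed_positive_cone: "closed (positive_cone :: 'a::banach_lattice complexification set)"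
  unfolding closed_sequential_limits
proof (intro allI impI, elim conjE)
  fix z :: "nat \<Rightarrow> 'a complexification" and l
  assume z: "\<forall>n. z n \<in> positive_cone" and l: "z \<longlonglongrightarrow> l"
  have "(\<lambda>n. re_part (z n)) \<longlonglongrightarrow> re_part l" "(\<lambda>n. im_part (z n)) \<longlonglongrightarrow> im_part l"
    using bounded_linear.tendsto[OF bounded_linear_re_part l]
      bounded_linear.tendsto[OF bounded_linear_im_part l] by auto
  then show "l \<in> positive_cone"
    using z LIMSEQ_unique[OF _ tendsto_const[of 0]] tendsto_nonneg_lattice[of "\<lambda>n. re_part (z n)"]
    by (auto simp: positive_cone_iff)
qed

lemma positive_cone_sum:
  "(\<And>q. q \<in> Q \<Longrightarrow> u q \<in> positive_cone) \<Longrightarrow> (\<Sum>q\<in>Q. u q) \<in> positive_cone"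
  by (induction Q rule: infinite_finite_induct) (auto simp: positive_cone_zero positive_cone_add)

lemma integral_positive_cone:
  fixes u :: "real \<Rightarrow> 'a::banach_lattice complexification"
  assumes "u integrable_on {a..b}" "\<And>s. s \<in> {a..b} \<Longrightarrow> u s \<in> positive_cone"
  shows "integral {a..b} u \<in> positive_cone"
  by (rule integral_closed_convex_cone[OF assms closed_positive_cone positive_cone_zero
        positive_cone_add positive_cone_scaleR])

lemma modulus_positive_cone: "z \<in> positive_cone \<Longrightarrow> modulus z = re_part z"
  using modulus_le[of z] abs_re_le_modulus[of z] by (auto simp: positive_cone_iff)

text \<open>The condition on \<open>w - z\<close> stands for an order relation on the
  complexification. On the cone the modulus is the real part, so monotonicity of the lattice norm
  transfers.\<close>

lemma norm_mono_positive_cone: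
  assumes "z \<in> positive_cone" "w - z \<in> positive_cone"
  shows "norm z \<le> norm w"
proof -
  have "w \<in> positive_cone" using positive_cone_add[OF assms] by simp
  then show ?thesis
    using assms unfolding norm_complexification_def
    by (auto simp: modulus_positive_cone positive_cone_iff minus_complexification_def
        intro!: norm_mono_nonneg)
qed

text \<open>Real and imaginary parts are each written as
  \<open>\<bar>x\<bar> - (\<bar>x\<bar> - x)\<close>. Estimates stable under sums and
  \<open>scaleC\<close> thereby extend from the cone to the whole space.\<close>

lemma positive_cone_decompose:
  obtains p q r s where "p \<in> positive_cone" "q \<in> positive_cone" "r \<in> positive_cone"
    "s \<in> positive_cone" "z = (p + (-1) *\<^sub>C q) + (\<i> *\<^sub>C r + (- \<i>) *\<^sub>C s)"
proof
  let ?x = "re_part z" and ?y = "im_part z"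
  show "Cplx \<bar>?x\<bar> 0 \<in> positive_cone" "Cplx (\<bar>?x\<bar> - ?x) 0 \<in> positive_cone"
    "Cplx \<bar>?y\<bar> 0 \<in> positive_cone" "Cplx (\<bar>?y\<bar> - ?y) 0 \<in> positive_cone"
    by (simp_all add: positive_cone_iff abs_ge_self)
  show "z = (Cplx \<bar>?x\<bar> 0 + (-1) *\<^sub>C Cplx (\<bar>?x\<bar> - ?x) 0)
      + (\<i> *\<^sub>C Cplx \<bar>?y\<bar> 0 + (- \<i>) *\<^sub>C Cplx (\<bar>?y\<bar> - ?y) 0)"
    by (simp add: scaleC_def complexification_simps)
qed

lemma modulus_sum: "modulus (\<Sum>q\<in>Q. u q) \<le> (\<Sum>q\<in>Q. modulus (u q))"
proof (induction Q rule: infinite_finite_induct)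
  case (insert x F)
  then show ?case using modulus_add[of "u x" "sum u F"] by (auto intro: order_trans add_left_mono)
qed (simp_all add: modulus_positive_cone positive_cone_zero, simp_all add: zero_complexification_def)

text \<open>The triangle inequality for \<open>modulus\<close> removes the phases, and positivity of
  the \<open>u q\<close> makes the resulting bound the modulus of a single vector.\<close>

lemma norm_sum_scaleC_le:
  assumes "\<And>q. q \<in> Q \<Longrightarrow> u q \<in> positive_cone"
  shows "norm (\<Sum>q\<in>Q. c q *\<^sub>C u q) \<le> norm (\<Sum>q\<in>Q. cmod (c q) *\<^sub>R u q)"
proof -
  have "modulus (\<Sum>q\<in>Q. c q *\<^sub>C u q) \<le> (\<Sum>q\<in>Q. modulus (c q *\<^sub>C u q))" by (rule modulus_sum)
  also have "\<dots> \<le> (\<Sum>q\<in>Q. cmod (c q) *\<^sub>R re_part (u q))"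
  proof (rule sum_mono)
    fix q assume "q \<in> Q"
    then show "modulus (c q *\<^sub>C u q) \<le> cmod (c q) *\<^sub>R re_part (u q)"
      using modulus_scaleC_le[of "c q" "u q"] modulus_positive_cone[OF assms] by simp
  qed
  also have "\<dots> = re_part (\<Sum>q\<in>Q. cmod (c q) *\<^sub>R u q)"
    by (simp add: linear_sum[OF bounded_linear.linear[OF bounded_linear_re_part]]
        scaleR_complexification_def)
  also have "\<dots> = modulus (\<Sum>q\<in>Q. cmod (c q) *\<^sub>R u q)"
    by (rule modulus_positive_cone[symmetric])
       (intro positive_cone_sum positive_cone_scaleR assms norm_ge_zero)
  finally show ?thesis
    unfolding norm_complexification_def by (intro norm_mono_nonneg modulus_nonneg)
qed

text \<open>Turning the functional on each Riemann sum by unimodular weights replaces the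
  Riesz decomposition of \<open>\<phi>\<close> into positive functionals.\<close>

lemma integral_functional_positive_cone_le:
  fixes u :: "real \<Rightarrow> 'a::banach_lattice complexification"
  assumes u: "continuous_on {a..b} u" and pos: "\<And>s. s \<in> {a..b} \<Longrightarrow> u s \<in> positive_cone"
    and \<phi>: "\<phi> \<in> dual_space"
  shows "integral {a..b} (\<lambda>s. cmod (\<phi> (u s))) \<le> onorm \<phi> * norm (integral {a..b} u)"
proof -
  have lin: "bounded_linear \<phi>" and hom: "\<And>c x. \<phi> (c *\<^sub>C x) = c * \<phi> x"
    using \<phi> by (auto simp: dual_space_def)
  let ?F = "division_filter {a..b}"
  have cont: "continuous_on {a..b} (\<lambda>s. cmod (\<phi> (u s)))"
    by (intro continuous_on_norm bounded_linear.continuous_on[OF lin] u)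
  have riemann: "((\<lambda>p. \<Sum>(x,k)\<in>p. measure lborel k *\<^sub>R f x) \<longlongrightarrow> integral {a..b} f) ?F"
    if "continuous_on {a..b} f" for f :: "real \<Rightarrow> 'c::banach"
    using integrable_integral[OF integrable_continuous_real[OF that]] has_integral_cbox[of f _ a b]
    by simp
  \<comment> \<open>The inequality is proved for the Riemann sums of both sides over each tagged
    division and passes to the limit.\<close>
  show ?thesis
  proof (rule tendsto_le[OF _ tendsto_mult[OF tendsto_const tendsto_norm[OF riemann[OF u]]] riemann[OF cont]])
    show "?F \<noteq> bot" using division_filter_not_empty[of a b] by simp
    show "\<forall>\<^sub>F p in ?F. (\<Sum>(x,k)\<in>p. measure lborel k *\<^sub>R cmod (\<phi> (u x)))
        \<le> onorm \<phi> * norm (\<Sum>(x,k)\<in>p. measure lborel k *\<^sub>R u x)"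
      using eventually_division_filter_tagged_division[of "{a..b}"]
    proof eventually_elim
      case (elim p)
      \<comment> \<open>The phase that rotates \<open>w\<close> onto the nonnegative real axis; the
        default 1 at 0 keeps its modulus equal to 1 everywhere.\<close>
      define g where "g w = (if w = 0 then 1 else cnj w / complex_of_real (cmod w))" for w
      have g: "g w * w = complex_of_real (cmod w)" "cmod (g w) = 1" for w
        by (auto simp: g_def norm_divide complex_norm_square[symmetric] power2_eq_square mult.commute)
      define c where "c q = complex_of_real (measure lborel (snd q)) * g (\<phi> (u (fst q)))" for q :: "real \<times> real set"
      have upos: "u (fst q) \<in> positive_cone" if "q \<in> p" for q
        using tag_in_interval[OF elim, of "fst q" "snd q"] that by (intro pos) auto
      have "complex_of_real (\<Sum>(x,k)\<in>p. measure lborel k *\<^sub>R cmod (\<phi> (u x)))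
          = (\<Sum>q\<in>p. c q * \<phi> (u (fst q)))"
        by (simp add: c_def g mult.assoc case_prod_unfold)
      also have "\<dots> = \<phi> (\<Sum>q\<in>p. c q *\<^sub>C u (fst q))"
        by (simp add: linear_sum[OF bounded_linear.linear[OF lin]] hom)
      finally have "(\<Sum>(x,k)\<in>p. measure lborel k *\<^sub>R cmod (\<phi> (u x))) \<le> cmod (\<phi> (\<Sum>q\<in>p. c q *\<^sub>C u (fst q)))"
        by (metis Re_complex_of_real complex_Re_le_cmod)
      also have "\<dots> \<le> onorm \<phi> * norm (\<Sum>q\<in>p. c q *\<^sub>C u (fst q))"
        by (rule onorm[OF lin])
      also have "\<dots> \<le> onorm \<phi> * norm (\<Sum>q\<in>p. cmod (c q) *\<^sub>R u (fst q))"
        by (intro mult_left_mono norm_sum_scaleC_le upos onorm_pos_le[OF lin])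
      also have "(\<Sum>q\<in>p. cmod (c q) *\<^sub>R u (fst q)) = (\<Sum>(x,k)\<in>p. measure lborel k *\<^sub>R u x)"
        by (simp add: c_def norm_mult g case_prod_unfold)
      finally show ?case .
    qed
  qed
qed

text \<open>A real norming functional \<open>f\<close> is complexified as
  \<open>f x - i f (i x)\<close>. The crude bound 2 is later absorbed into the constants.\<close>

lemma dual_space_norming:
  fixes y :: "'a::banach_lattice complexification"
  obtains \<phi> where "\<phi> \<in> dual_space" "onorm \<phi> \<le> 2" "norm y \<le> cmod (\<phi> y)"
proof -
  obtain f :: "'a complexification \<Rightarrow> real"
    where f: "linear f" "\<And>x. f x \<le> norm x" "f y = norm y"
    using Hahn_Banach_norming by blast
  have abs: "\<bar>f x\<bar> \<le> norm x" for x
    using f(2)[of x] f(2)[of "- x"] linear_neg[OF f(1), of x] by (auto simp: abs_le_iff)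
  define \<phi> where "\<phi> x = Complex (f x) (- f (\<i> *\<^sub>C x))" for x
  have lin_f: "f (a *\<^sub>R x + b *\<^sub>R z) = a * f x + b * f z" for a b x z
    using f(1) by (simp add: linear_add linear_scale)
  have lin_i: "\<i> *\<^sub>C (x + z) = \<i> *\<^sub>C x + \<i> *\<^sub>C z" "\<i> *\<^sub>C (a *\<^sub>R x) = a *\<^sub>R \<i> *\<^sub>C x"
    for x z :: "'a complexification" and a
    by (simp_all add: scaleC_def complexification_simps algebra_simps)
  have cmod: "cmod (\<phi> x) \<le> 2 * norm x" for x
  proof -
    have "cmod (\<phi> x) \<le> \<bar>f x\<bar> + \<bar>f (\<i> *\<^sub>C x)\<bar>"
      using cmod_le[of "\<phi> x"] by (simp add: \<phi>_def)
    also have "\<dots> \<le> norm x + norm (\<i> *\<^sub>C x)" by (intro add_mono abs)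
    finally show ?thesis by (simp add: norm_scaleC)
  qed
  have "bounded_linear \<phi>"
  proof (rule bounded_linear_intro[where K = 2])
    show "\<phi> (x + z) = \<phi> x + \<phi> z" for x z
      by (simp add: \<phi>_def lin_i linear_add[OF f(1)] complex_eq_iff)
    show "\<phi> (a *\<^sub>R x) = a *\<^sub>R \<phi> x" for a x
      by (simp add: \<phi>_def lin_i linear_scale[OF f(1)] complex_eq_iff)
  qed (use cmod in \<open>simp add: mult.commute\<close>)
  moreover have "\<phi> (c *\<^sub>C x) = c * \<phi> x" for c x
  proof -
    have "c *\<^sub>C x = Re c *\<^sub>R x + Im c *\<^sub>R \<i> *\<^sub>C x"
      "\<i> *\<^sub>C c *\<^sub>C x = Re c *\<^sub>R \<i> *\<^sub>C x + (- Im c) *\<^sub>R x"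
      by (simp_all add: scaleC_def complexification_simps algebra_simps)
    then show ?thesis
      by (simp add: \<phi>_def lin_f complex_eq_iff del: scaleR_minus_left)
  qed
  ultimately have "\<phi> \<in> dual_space" by (simp add: dual_space_def)
  moreover have "onorm \<phi> \<le> 2" using cmod by (intro onorm_bound) auto
  moreover have "norm y \<le> cmod (\<phi> y)"
    using complex_Re_le_cmod[of "\<phi> y"] by (simp add: \<phi>_def f(3))
  ultimately show thesis by (rule that)
qed

section \<open>Exponentially weighted integrals\<close>

text \<open>Integration by parts with the primitive of \<open>f\<close> that vanishes at
  \<open>a\<close>, so only the boundary term at \<open>b\<close> survives. It makes bounds on
  unweighted integrals usable under the exponential weight.\<close>

lemma exp_weight_has_integral:
  fixes f :: "real \<Rightarrow> 'b::banach"
  assumes f: "continuous_on {a..b} f" and ab: "a \<le> b"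
  shows "((\<lambda>s. exp (- \<delta> * s) *\<^sub>R f s) has_integral
    exp (- \<delta> * b) *\<^sub>R integral {a..b} f
      + integral {a..b} (\<lambda>s. (\<delta> * exp (- \<delta> * s)) *\<^sub>R integral {a..s} f)) {a..b}"
proof -
  define G where "G s = integral {a..s} f" for s
  have G: "(G has_vector_derivative f s) (at s within {a..b})" if "s \<in> {a..b}" for s
    unfolding G_def by (rule integral_has_vector_derivative[OF f that])
  have contG: "continuous_on {a..b} G"
    using G has_vector_derivative_continuous by (metis continuous_on_eq_continuous_within)
  have 1: "((\<lambda>s. exp (- \<delta> * s) *\<^sub>R f s - (\<delta> * exp (- \<delta> * s)) *\<^sub>R G s) has_integral
      exp (- \<delta> * b) *\<^sub>R G b - exp (- \<delta> * a) *\<^sub>R G a) {a..b}"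
  proof (rule fundamental_theorem_of_calculus[OF ab])
    fix s assume s: "s \<in> {a..b}"
    have "((\<lambda>s. exp (- \<delta> * s)) has_vector_derivative - \<delta> * exp (- \<delta> * s)) (at s within {a..b})"
      unfolding has_real_derivative_iff_has_vector_derivative[symmetric]
      by (auto intro!: derivative_eq_intros)
    from bounded_bilinear.has_vector_derivative[OF bounded_bilinear_scaleR this G[OF s]]
    show "((\<lambda>s. exp (- \<delta> * s) *\<^sub>R G s) has_vector_derivative
        exp (- \<delta> * s) *\<^sub>R f s - (\<delta> * exp (- \<delta> * s)) *\<^sub>R G s) (at s within {a..b})"
      by simp
  qed
  have "((\<lambda>s. (\<delta> * exp (- \<delta> * s)) *\<^sub>R G s) has_integral
      integral {a..b} (\<lambda>s. (\<delta> * exp (- \<delta> * s)) *\<^sub>R G s)) {a..b}"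
    by (intro integrable_integral integrable_continuous_real continuous_intros contG)
  from has_integral_add[OF 1 this] show ?thesis
    by (simp add: G_def)
qed

lemma integral_exp_decay:
  assumes "a \<le> (b::real)"
  shows "((\<lambda>s. \<delta> * exp (- \<delta> * s)) has_integral exp (- \<delta> * a) - exp (- \<delta> * b)) {a..b}"
proof -
  have "((\<lambda>s. \<delta> * exp (- \<delta> * s)) has_integral - exp (- \<delta> * b) - - exp (- \<delta> * a)) {a..b}"
    by (rule fundamental_theorem_of_calculus[OF assms])
       (auto intro!: derivative_eq_intros simp flip: has_real_derivative_iff_has_vector_derivative)
  then show ?thesis by simp
qed

text \<open>After integration by parts the boundary term contributes
  \<open>M * exp (- \<delta> * b)\<close> and the remaining integral \<open>M\<close> times the
  decrease of the exponential from \<open>a\<close> to \<open>b\<close>; the sum telescopes.\<close>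

lemma norm_integral_exp_weight_le:
  fixes f :: "real \<Rightarrow> 'b::banach"
  assumes f: "continuous_on {a..b} f" and ab: "a \<le> b" and "0 \<le> \<delta>"
    and M: "\<And>s. s \<in> {a..b} \<Longrightarrow> norm (integral {a..s} f) \<le> M"
  shows "norm (integral {a..b} (\<lambda>s. exp (- \<delta> * s) *\<^sub>R f s)) \<le> M * exp (- \<delta> * a)"
proof -
  have cont: "continuous_on {a..b} (\<lambda>s. integral {a..s} f)"
    by (rule indefinite_integral_continuous_1[OF integrable_continuous_real[OF f]])
  have bound: "norm (integral {a..b} (\<lambda>s. (\<delta> * exp (- \<delta> * s)) *\<^sub>R integral {a..s} f))
      \<le> integral {a..b} (\<lambda>s. M * (\<delta> * exp (- \<delta> * s)))"
  proof (rule integral_norm_bound_integral)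
    show "(\<lambda>s. (\<delta> * exp (- \<delta> * s)) *\<^sub>R integral {a..s} f) integrable_on {a..b}"
      by (intro integrable_continuous_real continuous_intros cont)
    show "(\<lambda>s. M * (\<delta> * exp (- \<delta> * s))) integrable_on {a..b}"
      by (intro integrable_continuous_real continuous_intros)
    show "norm ((\<delta> * exp (- \<delta> * s)) *\<^sub>R integral {a..s} f) \<le> M * (\<delta> * exp (- \<delta> * s))"
      if "s \<in> {a..b}" for s
      using mult_right_mono[OF M[OF that], of "\<delta> * exp (- \<delta> * s)"] \<open>0 \<le> \<delta>\<close>
      by (simp add: mult.commute)
  qed
  have "integral {a..b} (\<lambda>s. M * (\<delta> * exp (- \<delta> * s))) = M * (exp (- \<delta> * a) - exp (- \<delta> * b))"
    by (rule integral_unique[OF has_integral_mult_right[OF integral_exp_decay[OF ab]]])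
  moreover have "norm (exp (- \<delta> * b) *\<^sub>R integral {a..b} f) \<le> M * exp (- \<delta> * b)"
    using mult_right_mono[OF M[of b], of "exp (- \<delta> * b)"] ab by (simp add: mult.commute)
  ultimately have "norm (exp (- \<delta> * b) *\<^sub>R integral {a..b} f
      + integral {a..b} (\<lambda>s. (\<delta> * exp (- \<delta> * s)) *\<^sub>R integral {a..s} f)) \<le> M * exp (- \<delta> * a)"
    using bound norm_triangle_ineq[of "exp (- \<delta> * b) *\<^sub>R integral {a..b} f"
        "integral {a..b} (\<lambda>s. (\<delta> * exp (- \<delta> * s)) *\<^sub>R integral {a..s} f)"]
    unfolding right_diff_distrib by linarith
  then show ?thesis
    using integral_unique[OF exp_weight_has_integral[OF f ab, of \<delta>]] by simp
qed

text \<open>Integration by parts allows the primitive of \<open>f\<close> to be replaced by its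
  bound \<open>C * s\<close>, which is then integrated exactly.\<close>

lemma integral_exp_weight_le:
  fixes f :: "real \<Rightarrow> real"
  assumes f: "continuous_on {0..t} f" and "0 \<le> t" "0 < \<alpha>" "0 \<le> C"
    and C: "\<And>s. s \<in> {0..t} \<Longrightarrow> integral {0..s} f \<le> C * s"
  shows "integral {0..t} (\<lambda>s. exp (- \<alpha> * s) * f s) \<le> C / \<alpha>"
proof -
  have cont: "continuous_on {0..t} (\<lambda>s. integral {0..s} f)"
    by (rule indefinite_integral_continuous_1[OF integrable_continuous_real[OF f]])
  \<comment> \<open>An explicit antiderivative of the weighted linear bound: its
    \<open>C * s\<close> part cancels the boundary term at \<open>t\<close>, and
    \<open>- K 0\<close> supplies \<open>C / \<alpha>\<close>.\<close>
  define K where "K s = - (C * s + C / \<alpha>) * exp (- \<alpha> * s)" for s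
  have K: "((\<lambda>s. \<alpha> * exp (- \<alpha> * s) * (C * s)) has_integral K t - K 0) {0..t}"
    unfolding K_def
    by (rule fundamental_theorem_of_calculus[OF \<open>0 \<le> t\<close>])
       (use \<open>0 < \<alpha>\<close> in \<open>auto intro!: derivative_eq_intros
          simp: field_simps simp flip: has_real_derivative_iff_has_vector_derivative\<close>)
  have "integral {0..t} (\<lambda>s. exp (- \<alpha> * s) * f s) =
      exp (- \<alpha> * t) * integral {0..t} f + integral {0..t} (\<lambda>s. \<alpha> * exp (- \<alpha> * s) * integral {0..s} f)"
    using integral_unique[OF exp_weight_has_integral[OF f \<open>0 \<le> t\<close>, of \<alpha>]] by simp
  also have "\<dots> \<le> exp (- \<alpha> * t) * (C * t) + integral {0..t} (\<lambda>s. \<alpha> * exp (- \<alpha> * s) * (C * s))"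
  proof (intro add_mono mult_left_mono integral_le C)
    show "(\<lambda>s. \<alpha> * exp (- \<alpha> * s) * integral {0..s} f) integrable_on {0..t}"
      by (intro integrable_continuous_real continuous_intros cont)
    show "(\<lambda>s. \<alpha> * exp (- \<alpha> * s) * (C * s)) integrable_on {0..t}"
      by (intro integrable_continuous_real continuous_intros)
  qed (use \<open>0 \<le> t\<close> \<open>0 < \<alpha>\<close> in auto)
  also have "\<dots> = exp (- \<alpha> * t) * (C * t) + (K t - K 0)"
    by (simp only: integral_unique[OF K])
  also have "\<dots> = C / \<alpha> - C / \<alpha> * exp (- \<alpha> * t)" by (simp add: K_def algebra_simps)
  also have "\<dots> \<le> C / \<alpha>" using assms by simp
  finally show ?thesis .
qed

text \<open>Damping turns boundedness of the primitive into convergence: the part of the weighted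
  integral beyond \<open>a\<close> is at most \<open>2 * M * exp (- \<delta> * a)\<close>.\<close>

lemma exp_weight_integral_convergent:
  fixes f :: "real \<Rightarrow> 'b::banach"
  assumes f: "continuous_on {0..} f" and \<delta>: "0 < \<delta>"
    and M: "\<And>t. 0 \<le> t \<Longrightarrow> norm (integral {0..t} f) \<le> M"
  obtains l where "((\<lambda>t. integral {0..t} (\<lambda>s. exp (- \<delta> * s) *\<^sub>R f s)) \<longlongrightarrow> l) at_top"
proof -
  define H where "H t = integral {0..t} (\<lambda>s. exp (- \<delta> * s) *\<^sub>R f s)" for t
  have fc: "continuous_on {a..b} f" if "0 \<le> a" for a b
    using that by (intro continuous_on_subset[OF f]) auto
  have diff: "norm (H b - H a) \<le> 2 * M * exp (- \<delta> * a)" if "0 \<le> a" "a \<le> b" for a b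
  proof -
    have "H a + integral {a..b} (\<lambda>s. exp (- \<delta> * s) *\<^sub>R f s) = H b"
      unfolding H_def
      by (rule Henstock_Kurzweil_Integration.integral_combine[OF that], rule integrable_continuous_real)
         (intro continuous_intros fc order_refl)
    moreover have "norm (integral {a..b} (\<lambda>s. exp (- \<delta> * s) *\<^sub>R f s)) \<le> 2 * M * exp (- \<delta> * a)"
    proof (rule norm_integral_exp_weight_le)
      fix s assume s: "s \<in> {a..b}"
      have "integral {0..a} f + integral {a..s} f = integral {0..s} f"
        using that s by (intro Henstock_Kurzweil_Integration.integral_combine[OF _ _ integrable_continuous_real[OF fc]]) auto
      then have "integral {a..s} f = integral {0..s} f - integral {0..a} f"
        by (simp add: algebra_simps)
      then show "norm (integral {a..s} f) \<le> 2 * M"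
        using M[of s] M[of a] that s norm_triangle_ineq4[of "integral {0..s} f" "integral {0..a} f"]
        by simp
    qed (use that \<delta> fc in auto)
    ultimately show ?thesis by (metis add_diff_cancel_left')
  qed
  have lim0: "((\<lambda>t. 2 * M * exp (- \<delta> * t)) \<longlongrightarrow> 0) at_top"
  proof -
    have "filterlim (\<lambda>t. - \<delta> * t) at_bot at_top"
      using \<delta> by (intro filterlim_tendsto_neg_mult_at_bot[OF tendsto_const]) (auto simp: filterlim_ident)
    from filterlim_compose[OF exp_at_bot this] show ?thesis
      by (intro tendsto_mult_right_zero)
  qed
  \<comment> \<open>The limit is taken first along the integers; the same tail estimate then extends
    it to all real \<open>t\<close>.\<close>
  have "Cauchy (\<lambda>n. H (real n))"
  proof (rule CauchyI')
    fix e :: real assume "0 < e"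
    have "\<forall>\<^sub>F n in sequentially. 2 * M * exp (- \<delta> * real n) < e"
      using filterlim_compose[OF lim0 filterlim_real_sequentially] \<open>0 < e\<close> by (rule order_tendstoD)
    then obtain N where N: "\<And>n. n \<ge> N \<Longrightarrow> 2 * M * exp (- \<delta> * real n) < e"
      by (auto simp: eventually_sequentially)
    show "\<exists>M. \<forall>m\<ge>M. \<forall>n>m. dist (H (real m)) (H (real n)) < e"
    proof (intro exI allI impI)
      fix m n :: nat assume "m \<ge> N" "n > m"
      then show "dist (H (real m)) (H (real n)) < e"
        using diff[of "real m" "real n"] N[of m] by (simp add: dist_norm norm_minus_commute)
    qed
  qed
  then obtain l where l: "(\<lambda>n. H (real n)) \<longlonglongrightarrow> l"
    by (meson Cauchy_convergent convergent_def)
  have "norm (H t - l) \<le> 2 * M * exp (- \<delta> * t)" if "0 \<le> t" for t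
  proof (rule tendsto_upperbound)
    show "(\<lambda>n. norm (H t - H (real n))) \<longlonglongrightarrow> norm (H t - l)"
      by (intro tendsto_intros l)
    show "\<forall>\<^sub>F n in sequentially. norm (H t - H (real n)) \<le> 2 * M * exp (- \<delta> * t)"
      using filterlim_real_sequentially[unfolded filterlim_at_top, rule_format, of t]
    proof eventually_elim
      case (elim n)
      then show ?case using diff[OF that, of "real n"] by (simp add: norm_minus_commute)
    qed
  qed simp
  then have "\<forall>\<^sub>F t in at_top. norm (H t - l) \<le> 2 * M * exp (- \<delta> * t)"
    by (auto intro: eventually_mono[OF eventually_ge_at_top[of 0]])
  then have "((\<lambda>t. H t - l) \<longlongrightarrow> 0) at_top" using lim0 by (rule Lim_null_comparison)
  then have "(H \<longlongrightarrow> l) at_top" by (rule Lim_null[THEN iffD2])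
  then show thesis unfolding H_def by (rule that)
qed

section \<open>Strongly continuous semigroups\<close>

locale c0_semigroup =
  fixes T :: "real \<Rightarrow> 'a::banach_lattice complexification \<Rightarrow> 'a complexification"
  assumes C0: "C0_semigroup T"
begin

section \<open>Growth bounds and continuity of orbits\<close>

lemma T_linear: "0 \<le> t \<Longrightarrow> bounded_linear (T t)"
  and T_scaleC: "0 \<le> t \<Longrightarrow> T t (c *\<^sub>C x) = c *\<^sub>C T t x"
  and T_zero [simp]: "T 0 x = x"
  and T_add: "0 \<le> s \<Longrightarrow> 0 \<le> t \<Longrightarrow> T (s + t) x = T s (T t x)"
  and T_tendsto: "((\<lambda>t. T t x) \<longlongrightarrow> x) (at_right 0)"
  using C0 unfolding C0_semigroup_def bounded_clinear_def by blast+

lemma T_commute: "0 \<le> s \<Longrightarrow> 0 \<le> t \<Longrightarrow> T s (T t x) = T t (T s x)"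
  by (metis T_add add.commute)

text \<open>Otherwise some operators \<open>T (s n)\<close> with \<open>s n\<close> tending to 0
  would have unbounded norms although every orbit converges, against uniform boundedness.\<close>

lemma bounded_near_zero:
  obtains \<delta> M where "0 < \<delta>" "1 \<le> M" "\<And>s x. 0 \<le> s \<Longrightarrow> s \<le> \<delta> \<Longrightarrow> norm (T s x) \<le> M * norm x"
proof -
  have "\<exists>\<delta>>0. \<exists>M\<ge>1. \<forall>s\<in>{0..\<delta>}. \<forall>x. norm (T s x) \<le> M * norm x"
  proof (rule ccontr)
    assume neg: "\<not> ?thesis"
    have "\<exists>s x. 0 \<le> s \<and> s \<le> 1 / real (Suc n) \<and> real (Suc n) * norm x < norm (T s x)" for n
    proof -
      have "\<not> (\<forall>s\<in>{0..1 / real (Suc n)}. \<forall>x. norm (T s x) \<le> real (Suc n) * norm x)"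
        using neg by (metis of_nat_0_less_iff zero_less_Suc zero_less_divide_1_iff le_add1 of_nat_1 of_nat_le_iff plus_1_eq_Suc)
      then show ?thesis by (auto simp: not_le)
    qed
    then obtain s x where s: "\<And>n. 0 \<le> s n" "\<And>n. s n \<le> 1 / real (Suc n)"
      and x: "\<And>n. real (Suc n) * norm (x n) < norm (T (s n) (x n))" by metis
    have s0: "s \<longlonglongrightarrow> 0"
      by (rule tendsto_sandwich[OF _ _ tendsto_const LIMSEQ_Suc[OF lim_1_over_n]])
         (use s in auto)
    have "\<exists>C. \<forall>n\<in>UNIV. \<forall>y. norm (T (s n) y) \<le> C * norm y"
    proof (rule uniform_boundedness_seminorms)
      fix n
      show "continuous_on UNIV (\<lambda>y. norm (T (s n) y))"
        by (intro continuous_on_norm linear_continuous_on T_linear s)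
      show "norm (T (s n) (y + z)) \<le> norm (T (s n) y) + norm (T (s n) z)" for y z
        using linear_add[OF bounded_linear.linear[OF T_linear[OF s(1)[of n]]]] norm_triangle_ineq by metis
      show "norm (T (s n) (r *\<^sub>R y)) = \<bar>r\<bar> * norm (T (s n) y)" for r y
        by (simp add: linear_scale[OF bounded_linear.linear[OF T_linear[OF s(1)]]])
    next
      fix y
      \<comment> \<open>The times \<open>s n\<close> may equal 0, so the right limit is first read
        as continuity within the closed half-line.\<close>
      have "at 0 within {0..} = at_right (0::real)"
        unfolding at_within_def by (rule arg_cong[where f = "\<lambda>S. inf _ (principal S)"]) auto
      then have "continuous (at 0 within {0..}) (\<lambda>t. T t y)"
        using T_tendsto[of y] by (simp add: continuous_within)
      then have "(\<lambda>n. T (s n) y) \<longlonglongrightarrow> y"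
        using s s0 unfolding continuous_within_sequentially by (auto simp: o_def)
      then have "Bseq (\<lambda>n. T (s n) y)" by (metis convergentI Cauchy_Bseq convergent_Cauchy)
      then show "\<exists>M. \<forall>n\<in>UNIV. norm (T (s n) y) \<le> M" by (auto simp: Bseq_def)
    qed
    then obtain C where C: "\<And>n y. norm (T (s n) y) \<le> C * norm y" by auto
    obtain n where n: "C \<le> real n" using real_arch_simple by blast
    have "C * norm (x n) \<le> real (Suc n) * norm (x n)" using n by (intro mult_right_mono) auto
    then show False using x[of n] C[of n "x n"] by linarith
  qed
  then show thesis using that by (metis atLeastAtMost_iff)
qed

text \<open>The bound on \<open>{0..\<delta>}\<close> is iterated through the semigroup law;
  \<open>\<omega> = ln M / \<delta>\<close> turns the power \<open>M ^ k\<close> into an exponential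
  in \<open>t\<close>.\<close>

lemma exponential_bound:
  obtains M \<omega> where "1 \<le> M" "0 \<le> \<omega>" "\<And>t x. 0 \<le> t \<Longrightarrow> norm (T t x) \<le> M * exp (\<omega> * t) * norm x"
proof -
  obtain \<delta> M where \<delta>: "0 < \<delta>" and M: "1 \<le> M"
    and bound: "\<And>s x. 0 \<le> s \<Longrightarrow> s \<le> \<delta> \<Longrightarrow> norm (T s x) \<le> M * norm x"
    using bounded_near_zero by blast
  have iter: "norm (T t x) \<le> M ^ Suc k * norm x" if "0 \<le> t" "t \<le> real (Suc k) * \<delta>" for k t x
    using that
  proof (induction k arbitrary: t)
    case 0
    then show ?case using bound by simp
  next
    case (Suc k)
    show ?case
    proof (cases "t \<le> \<delta>")
      case True
      have "M * norm x \<le> M ^ Suc (Suc k) * norm x"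
        using M one_le_power[OF M, of "Suc k"] by (intro mult_right_mono) auto
      then show ?thesis using bound[OF Suc.prems(1) True, of x] by linarith
    next
      case False
      then have "norm (T t x) = norm (T \<delta> (T (t - \<delta>) x))"
        using T_add[of \<delta> "t - \<delta>" x] \<delta> by simp
      also have "\<dots> \<le> M * norm (T (t - \<delta>) x)" using \<delta> by (intro bound) auto
      also have "\<dots> \<le> M * (M ^ Suc k * norm x)"
        using Suc.prems False M by (intro mult_left_mono Suc.IH) (auto simp: algebra_simps)
      finally show ?thesis by (simp add: mult.assoc)
    qed
  qed
  show thesis
  proof (rule that[OF M, of "ln M / \<delta>"])
    show "0 \<le> ln M / \<delta>" using M \<delta> by simp
    fix t :: real and x :: "'a complexification" assume t: "0 \<le> t"
    define k where "k = nat \<lfloor>t / \<delta>\<rfloor>"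
    have k: "real k \<le> t / \<delta>" "t / \<delta> \<le> real (Suc k)"
      using t \<delta> unfolding k_def by (auto, linarith)
    have "norm (T t x) \<le> M * M ^ k * norm x"
      using iter[OF t, of k x] k(2) \<delta> by (simp add: field_simps)
    also have "M ^ k = exp (real k * ln M)" using M by (simp add: exp_of_nat_mult)
    also have "\<dots> \<le> exp (ln M / \<delta> * t)"
      using mult_right_mono[OF k(1), of "ln M"] M by (simp add: mult.commute)
    finally show "norm (T t x) \<le> M * exp (ln M / \<delta> * t) * norm x"
      using M by (simp add: mult_left_mono mult_right_mono)
  qed
qed

lemma locally_bounded:
  obtains M where "1 \<le> M" "\<And>s x. 0 \<le> s \<Longrightarrow> s \<le> t \<Longrightarrow> norm (T s x) \<le> M * norm x"
proof -
  obtain M \<omega> where M: "1 \<le> M" "0 \<le> \<omega>"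
    and bound: "\<And>t x. 0 \<le> t \<Longrightarrow> norm (T t x) \<le> M * exp (\<omega> * t) * norm x"
    using exponential_bound by blast
  show thesis
  proof (rule that[of "M * exp (\<omega> * max t 0)"])
    show "1 \<le> M * exp (\<omega> * max t 0)"
      using mult_mono[of 1 M 1 "exp (\<omega> * max t 0)"] M by simp
    fix s :: real and x :: "'a complexification" assume "0 \<le> s" "s \<le> t"
    then have "M * exp (\<omega> * s) * norm x \<le> M * exp (\<omega> * max t 0) * norm x"
      using M by (intro mult_right_mono mult_left_mono) (auto intro: mult_left_mono)
    then show "norm (T s x) \<le> M * exp (\<omega> * max t 0) * norm x"
      using bound[OF \<open>0 \<le> s\<close>] order_trans by blast
  qed
qed

text \<open>Right continuity at 0 spreads to both sides of every \<open>t\<close> through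
  \<open>T (s + h) x - T s x = T s (T h x - x)\<close> and local boundedness.\<close>

lemma orbit_continuous: "continuous_on {0..} (\<lambda>t. T t x)"
  unfolding continuous_on_iff
proof (intro ballI allI impI)
  fix t e :: real assume "t \<in> {0..}" "0 < e"
  then have t: "0 \<le> t" by simp
  obtain M where M: "1 \<le> M" and bound: "\<And>s x. 0 \<le> s \<Longrightarrow> s \<le> t \<Longrightarrow> norm (T s x) \<le> M * norm x"
    using locally_bounded[of t] by blast
  obtain M' where M': "1 \<le> M'" and bound': "\<And>s x. 0 \<le> s \<Longrightarrow> s \<le> t + 1 \<Longrightarrow> norm (T s x) \<le> M' * norm x"
    using locally_bounded[of "t + 1"] by blast
  have "0 < e / M'" using \<open>0 < e\<close> M' by simp
  then obtain d where d: "0 < d" and near: "\<And>h. 0 < h \<Longrightarrow> h < d \<Longrightarrow> dist (T h x) x < e / M'"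
    using T_tendsto[of x] unfolding Lim_within by (auto simp: dist_real_def)
  have near': "norm (T h x - x) < e / M'" if "0 \<le> h" "h < d" for h
    using near[of h] that \<open>0 < e / M'\<close> by (cases "h = 0") (auto simp: dist_norm)
  \<comment> \<open>The base point \<open>s\<close> is the earlier of the two times compared, so one
    estimate, uniform in \<open>s\<close>, handles approach from either side.\<close>
  have step: "norm (T (s + h) x - T s x) < e" if "0 \<le> s" "s \<le> t + 1" "0 \<le> h" "h < d" for s h
  proof -
    have "norm (T (s + h) x - T s x) = norm (T s (T h x - x))"
      using that by (simp add: T_add linear_diff[OF bounded_linear.linear[OF T_linear]])
    also have "\<dots> \<le> M' * norm (T h x - x)" using that by (intro bound') auto
    also have "\<dots> < e" using near'[OF that(3,4)] M' by (simp add: field_simps)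
    finally show ?thesis .
  qed
  show "\<exists>d>0. \<forall>s\<in>{0..}. dist s t < d \<longrightarrow> dist (T s x) (T t x) < e"
  proof (intro exI[of _ d] conjI ballI impI d)
    fix s :: real assume s: "s \<in> {0..}" "dist s t < d"
    show "dist (T s x) (T t x) < e"
    proof (cases "s \<le> t")
      case True
      then show ?thesis using step[of s "t - s"] s by (simp add: dist_norm dist_real_def norm_minus_commute)
    next
      case False
      then show ?thesis using step[of t "s - t"] s t by (simp add: dist_norm dist_real_def)
    qed
  qed
qed

lemma orbit_continuous_Icc: "0 \<le> a \<Longrightarrow> continuous_on {a..b} (\<lambda>t. T t x)"
  by (rule continuous_on_subset[OF orbit_continuous]) auto

lemma orbit_integrable: "0 \<le> a \<Longrightarrow> (\<lambda>s. T s x) integrable_on {a..b}"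
  by (intro integrable_continuous_real orbit_continuous_Icc)

section \<open>Orbit integrals and the generator\<close>

definition orbit_integral :: "real \<Rightarrow> 'a complexification \<Rightarrow> 'a complexification" where
  "orbit_integral t x = integral {0..t} (\<lambda>s. T s x)"

lemma orbit_integral_linear:
  assumes t: "0 \<le> t"
  shows "bounded_linear (orbit_integral t)"
proof -
  obtain M where M: "1 \<le> M" and bound: "\<And>s x. 0 \<le> s \<Longrightarrow> s \<le> t \<Longrightarrow> norm (T s x) \<le> M * norm x"
    using locally_bounded[of t] by blast
  show ?thesis
  proof (rule bounded_linear_intro[where K = "M * t"])
    show "orbit_integral t (x + y) = orbit_integral t x + orbit_integral t y" for x y
    proof -
      have "orbit_integral t (x + y) = integral {0..t} (\<lambda>s. T s x + T s y)"
        unfolding orbit_integral_def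
        by (intro Henstock_Kurzweil_Integration.integral_cong)
           (simp add: linear_add[OF bounded_linear.linear[OF T_linear]])
      then show ?thesis
        by (simp add: orbit_integral_def Henstock_Kurzweil_Integration.integral_add orbit_integrable)
    qed
    show "orbit_integral t (r *\<^sub>R x) = r *\<^sub>R orbit_integral t x" for r x
    proof -
      have "orbit_integral t (r *\<^sub>R x) = integral {0..t} (\<lambda>s. r *\<^sub>R T s x)"
        unfolding orbit_integral_def
        by (intro Henstock_Kurzweil_Integration.integral_cong)
           (simp add: linear_scale[OF bounded_linear.linear[OF T_linear]])
      then show ?thesis by (simp add: orbit_integral_def)
    qed
    show "norm (orbit_integral t x) \<le> norm x * (M * t)" for x
      using integral_bound[OF t orbit_continuous_Icc[OF order_refl], where B = "M * norm x"] bound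
      by (simp add: orbit_integral_def mult.commute mult.left_commute)
  qed
qed

lemma T_orbit_integral:
  assumes "0 \<le> h" "0 \<le> t"
  shows "T h (orbit_integral t x) = orbit_integral t (T h x)"
    and "T h (orbit_integral t x) = orbit_integral (t + h) x - orbit_integral h x"
proof -
  have 1: "T h (orbit_integral t x) = integral {0..t} (\<lambda>s. T h (T s x))"
    using integral_linear[OF orbit_integrable[OF order_refl] T_linear[OF assms(1)]]
    by (simp add: orbit_integral_def o_def)
  also have "\<dots> = orbit_integral t (T h x)"
    unfolding orbit_integral_def
    by (intro Henstock_Kurzweil_Integration.integral_cong) (use assms T_commute in auto)
  finally show "T h (orbit_integral t x) = orbit_integral t (T h x)" .
  note 1
  also have "integral {0..t} (\<lambda>s. T h (T s x)) = integral {0..t} ((\<lambda>s. T s x) \<circ> (+) h)"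
    by (intro Henstock_Kurzweil_Integration.integral_cong) (use assms T_add in auto)
  also have "\<dots> = integral {h..t + h} (\<lambda>s. T s x)"
    using integral_shift_Icc_real[of 0 t "\<lambda>s. T s x" h] by simp
  also have "\<dots> = orbit_integral (t + h) x - orbit_integral h x"
    using Henstock_Kurzweil_Integration.integral_combine[OF _ _ orbit_integrable[OF order_refl], where c = h and b = "t + h"] assms
    by (simp add: orbit_integral_def algebra_simps)
  finally show "T h (orbit_integral t x) = orbit_integral (t + h) x - orbit_integral h x" .
qed

text \<open>Both sides equal the integral up to \<open>t + h\<close> minus those up to
  \<open>t\<close> and up to \<open>h\<close>, an expression symmetric in the two times.\<close>

lemma T_orbit_integral_swap:
  assumes "0 \<le> h" "0 \<le> t"
  shows "T h (orbit_integral t x) - orbit_integral t x = T t (orbit_integral h x) - orbit_integral h x"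
  using T_orbit_integral(2)[OF assms, of x] T_orbit_integral(2)[OF assms(2,1), of x]
  by (simp add: add.commute)

lemma orbit_integral_average: "((\<lambda>h. orbit_integral h x /\<^sub>R h) \<longlongrightarrow> x) (at_right 0)"
proof -
  have "((\<lambda>u. integral {0..u} (\<lambda>s. T s x)) has_vector_derivative T 0 x) (at 0 within {0..1})"
    by (intro integral_has_vector_derivative orbit_continuous_Icc) auto
  then have "((\<lambda>h. (1 / norm (h - 0)) *\<^sub>R (orbit_integral h x - (orbit_integral 0 x + (h - 0) *\<^sub>R x)))
      \<longlongrightarrow> 0) (at_right 0)"
    unfolding has_vector_derivative_def has_derivative_within orbit_integral_def
    by (simp add: at_within_Icc_at_right)
  moreover have "\<forall>\<^sub>F h in at_right 0. (1 / norm (h - 0)) *\<^sub>R (orbit_integral h x - (orbit_integral 0 x + (h - 0) *\<^sub>R x))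
      = orbit_integral h x /\<^sub>R h - x"
    using eventually_at_right_less[of 0]
    by eventually_elim (simp add: orbit_integral_def algebra_simps divide_inverse)
  ultimately have "((\<lambda>h. orbit_integral h x /\<^sub>R h - x) \<longlongrightarrow> 0) (at_right 0)"
    by (rule Lim_transform_eventually)
  then show ?thesis by (rule Lim_null[THEN iffD2])
qed

text \<open>Existence of the limit and its value are kept together in one relation, so that no
  separate domain condition has to be carried along.\<close>

definition has_generator :: "'a complexification \<Rightarrow> 'a complexification \<Rightarrow> bool" where
  "has_generator x y \<longleftrightarrow> ((\<lambda>t. (T t x - x) /\<^sub>R t) \<longlongrightarrow> y) (at_right 0)"

lemma has_generator_iff: "has_generator x y \<longleftrightarrow> x \<in> generator_domain T \<and> generator T x = y"
proof
  show "x \<in> generator_domain T \<and> generator T x = y" if "has_generator x y"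
    using that unfolding has_generator_def generator_domain_def generator_def
    by (auto intro!: tendsto_Lim)
  show "has_generator x y" if "x \<in> generator_domain T \<and> generator T x = y"
    using that unfolding has_generator_def generator_domain_def generator_def
    by (auto simp: tendsto_Lim)
qed

text \<open>The integral up to \<open>t\<close> is applied to the difference quotient of
  \<open>x\<close>; the exchange with \<open>T h\<close> gives averages over \<open>{0..h}\<close>,
  which converge by \<open>orbit_integral_average\<close>.\<close>

lemma has_generator_orbit_integral:
  assumes "has_generator x y" "0 \<le> t"
  shows "orbit_integral t y = T t x - x"
proof (rule tendsto_unique)
  note lin = bounded_linear.linear[OF orbit_integral_linear[OF assms(2)]]
  show "((\<lambda>h. orbit_integral t ((T h x - x) /\<^sub>R h)) \<longlongrightarrow> orbit_integral t y) (at_right 0)"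
    using assms(1) unfolding has_generator_def
    by (intro bounded_linear.tendsto[OF orbit_integral_linear[OF assms(2)]])
  have "((\<lambda>h. T t (orbit_integral h x /\<^sub>R h) - orbit_integral h x /\<^sub>R h) \<longlongrightarrow> T t x - x) (at_right 0)"
    by (intro tendsto_diff bounded_linear.tendsto[OF T_linear[OF assms(2)]] orbit_integral_average)
  moreover have "\<forall>\<^sub>F h in at_right 0. T t (orbit_integral h x /\<^sub>R h) - orbit_integral h x /\<^sub>R h
      = orbit_integral t ((T h x - x) /\<^sub>R h)"
    using eventually_at_right_less[of 0]
  proof eventually_elim
    case (elim h)
    then show ?case
      using T_orbit_integral_swap[of h t x] assms(2)
      by (simp add: linear_scale[OF lin] linear_diff[OF lin] T_orbit_integral(1)[symmetric]
          linear_scale[OF bounded_linear.linear[OF T_linear]] scaleR_diff_right[symmetric])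
  qed
  ultimately show "((\<lambda>h. orbit_integral t ((T h x - x) /\<^sub>R h)) \<longlongrightarrow> T t x - x) (at_right 0)"
    by (rule Lim_transform_eventually)
qed simp

end

section \<open>Rescaling and resolvents\<close>

text \<open>Rescaling shifts the generator by \<open>- \<mu>\<close>; the orbit integrals of the
  rescaled semigroup are the truncated Laplace integrals of \<open>T\<close> at \<mu>.\<close>

definition rescale ::
    "complex \<Rightarrow> (real \<Rightarrow> 'a::banach_lattice complexification \<Rightarrow> 'a complexification) \<Rightarrow>
     real \<Rightarrow> 'a complexification \<Rightarrow> 'a complexification" where
  "rescale \<mu> T s x = exp (- (\<mu> * complex_of_real s)) *\<^sub>C T s x"

lemma rescale_rescale: "rescale \<nu> (rescale \<mu> T) = rescale (\<mu> + \<nu>) T"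
  by (intro ext) (simp add: rescale_def scaleC_scaleC exp_add[symmetric] algebra_simps)

lemma rescale_zero [simp]: "rescale 0 T = T"
  by (intro ext) (simp add: rescale_def)

lemma rescale_of_real: "rescale (complex_of_real \<mu>) T s x = exp (- \<mu> * s) *\<^sub>R T s x"
  by (simp add: rescale_def scaleC_of_real[symmetric] exp_of_real[symmetric])

lemma c0_semigroup_rescale:
  assumes "c0_semigroup T"
  shows "c0_semigroup (rescale \<mu> T)"
proof -
  interpret c0_semigroup T by fact
  let ?e = "\<lambda>s. exp (- (\<mu> * complex_of_real s))"
  have "bounded_clinear (\<lambda>x. ?e s *\<^sub>C T s x)" if "0 \<le> s" for s
    unfolding bounded_clinear_def
    using bounded_linear_compose[OF bounded_linear_scaleC_right T_linear[OF that]] T_scaleC[OF that]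
    by (auto simp: scaleC_scaleC mult.commute)
  then have "bounded_clinear (rescale \<mu> T s)" if "0 \<le> s" for s
    using that by (simp add: rescale_def[abs_def])
  moreover have "?e (s + t) *\<^sub>C T (s + t) x = ?e s *\<^sub>C T s (?e t *\<^sub>C T t x)" if "0 \<le> s" "0 \<le> t" for s t x
    using that by (simp add: T_add T_scaleC scaleC_scaleC distrib_left exp_add[symmetric] add.commute)
  moreover have "((\<lambda>t. ?e t *\<^sub>C T t x) \<longlongrightarrow> x) (at_right 0)" for x
  proof -
    have "((\<lambda>t. ?e t) \<longlongrightarrow> ?e 0) (at_right 0)" by (intro tendsto_intros)
    from bounded_bilinear.tendsto[OF bounded_bilinear_scaleC this T_tendsto]
    show ?thesis by simp
  qed
  ultimately show ?thesis
    by unfold_locales (simp add: C0_semigroup_def rescale_def)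
qed

lemma has_generator_rescale:
  assumes "c0_semigroup T" and gen: "c0_semigroup.has_generator T x y"
  shows "c0_semigroup.has_generator (rescale \<mu> T) x (y - \<mu> *\<^sub>C x)"
proof -
  interpret c0_semigroup T by fact
  interpret U: c0_semigroup "rescale \<mu> T" by (rule c0_semigroup_rescale) fact
  let ?e = "\<lambda>s. exp (- (\<mu> * complex_of_real s))"
  have "((\<lambda>h. exp (- \<mu> * h)) has_field_derivative - \<mu>) (at 0)"
    by (auto intro!: derivative_eq_intros)
  then have "((\<lambda>h. (exp (- \<mu> * h) - 1) / h) \<longlongrightarrow> - \<mu>) (at 0)"
    by (simp add: DERIV_def)
  \<comment> \<open>The complex derivative at 0 is restricted to positive real increments.\<close>
  moreover have "filterlim complex_of_real (at 0) (at_right 0)"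
  proof (rule filterlim_atI)
    show "\<forall>\<^sub>F h in at_right 0. complex_of_real h \<noteq> 0"
      using eventually_at_right_less[of 0] by eventually_elim simp
  qed (auto intro!: tendsto_eq_intros)
  ultimately have e': "((\<lambda>h. (?e h - 1) / complex_of_real h) \<longlongrightarrow> - \<mu>) (at_right 0)"
    by (auto dest: filterlim_compose)
  have "((\<lambda>t. ?e t) \<longlongrightarrow> ?e 0) (at_right 0)" by (intro tendsto_intros)
  from tendsto_add[OF bounded_bilinear.tendsto[OF bounded_bilinear_scaleC this gen[unfolded has_generator_def]]
      bounded_bilinear.tendsto[OF bounded_bilinear_scaleC e' tendsto_const[of x]]]
  have "((\<lambda>h. ?e h *\<^sub>C ((T h x - x) /\<^sub>R h) + ((?e h - 1) / complex_of_real h) *\<^sub>C x)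
      \<longlongrightarrow> y - \<mu> *\<^sub>C x) (at_right 0)"
    by (simp add: bounded_bilinear.minus_left[OF bounded_bilinear_scaleC])
  moreover have "?e h *\<^sub>C ((T h x - x) /\<^sub>R h) + ((?e h - 1) / complex_of_real h) *\<^sub>C x
      = (rescale \<mu> T h x - x) /\<^sub>R h" for h
  proof -
    have "?e h *\<^sub>C ((T h x - x) /\<^sub>R h) = (rescale \<mu> T h x - ?e h *\<^sub>C x) /\<^sub>R h"
      by (simp add: rescale_def scaleC_scaleR scaleR_scaleC scaleR_diff_right
          bounded_bilinear.diff_right[OF bounded_bilinear_scaleC])
    moreover have "((?e h - 1) / complex_of_real h) *\<^sub>C x = (?e h *\<^sub>C x - x) /\<^sub>R h"
      by (simp add: scaleR_scaleC divide_inverse right_diff_distrib scaleC_scaleC mult.commute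
          bounded_bilinear.diff_left[OF bounded_bilinear_scaleC] scaleC_of_real[symmetric]
          bounded_bilinear.diff_right[OF bounded_bilinear_scaleC])
    ultimately show ?thesis by (simp add: scaleR_diff_right)
  qed
  ultimately show ?thesis unfolding U.has_generator_def by simp
qed

context c0_semigroup
begin

text \<open>With \<open>G = - A\<close> the generator, \<open>- \<mu> - A\<close> is
  \<open>G - \<mu>\<close>, so applying its inverse to \<open>y\<close> amounts to solving
  \<open>G z = y + \<mu> z\<close>.\<close>

lemma resolvent_equation:
  assumes "- \<mu> \<in> semigroup_rho T"
  shows "has_generator (semigroup_R T (- \<mu>) y) (y + \<mu> *\<^sub>C semigroup_R T (- \<mu>) y)"
    and "has_generator z (y + \<mu> *\<^sub>C z) \<Longrightarrow> z = semigroup_R T (- \<mu>) y"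
proof -
  let ?f = "\<lambda>x. (- \<mu>) *\<^sub>C x - negative_generator T x" and ?D = "generator_domain T"
  have bij: "bij_betw ?f ?D UNIV" using assms by (simp add: resolvent_set_def)
  have f: "?f x = generator T x - \<mu> *\<^sub>C x" for x
    by (simp add: negative_generator_def bounded_bilinear.minus_left[OF bounded_bilinear_scaleC])
  have R: "semigroup_R T (- \<mu>) y = inv_into ?D ?f y"
    by (simp add: resolvent_def)
  have img: "y \<in> ?f ` ?D" using bij by (auto simp: bij_betw_def)
  have "?f (semigroup_R T (- \<mu>) y) = y" unfolding R by (rule f_inv_into_f[OF img])
  moreover have "semigroup_R T (- \<mu>) y \<in> ?D" unfolding R by (rule inv_into_into[OF img])
  ultimately show "has_generator (semigroup_R T (- \<mu>) y) (y + \<mu> *\<^sub>C semigroup_R T (- \<mu>) y)"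
    unfolding has_generator_iff f by (auto simp: algebra_simps)
  assume z: "has_generator z (y + \<mu> *\<^sub>C z)"
  then have "?f z = y" "z \<in> ?D" unfolding has_generator_iff f by auto
  then show "z = semigroup_R T (- \<mu>) y"
    unfolding R by (intro inv_into_f_eq[symmetric] bij_betw_imp_inj_on[OF bij])
qed

text \<open>Here \<open>L\<close> is a two-sided inverse of \<open>\<mu> - G\<close>, with
  \<open>G\<close> the generator, whereas the resolvent at \<open>- \<mu>\<close> inverts
  \<open>G - \<mu>\<close>; hence the minus sign.\<close>

lemma resolvent_setI:
  assumes L: "bounded_clinear L"
    and right: "\<And>y. has_generator (L y) (\<mu> *\<^sub>C L y - y)"
    and left: "\<And>x y. has_generator x y \<Longrightarrow> L (\<mu> *\<^sub>C x - y) = x"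
  shows "- \<mu> \<in> semigroup_rho T" and "semigroup_R T (- \<mu>) = (\<lambda>y. - L y)"
proof -
  let ?f = "\<lambda>x. (- \<mu>) *\<^sub>C x - negative_generator T x" and ?D = "generator_domain T"
  note lin = bounded_linear.linear[OF L[unfolded bounded_clinear_def, THEN conjunct1]]
  have hom: "L (c *\<^sub>C x) = c *\<^sub>C L x" for c x using L by (simp add: bounded_clinear_def)
  have f: "?f x = generator T x - \<mu> *\<^sub>C x" for x
    by (simp add: negative_generator_def bounded_bilinear.minus_left[OF bounded_bilinear_scaleC])
  have inj: "- L (?f x) = x" if "x \<in> ?D" for x
  proof -
    have "has_generator x (generator T x)" using that by (simp add: has_generator_iff)
    from left[OF this] have "L (- ?f x) = x" by (simp add: f)
    then show ?thesis by (simp only: linear_neg[OF lin])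
  qed
  have surj: "?f (- L y) = y" "- L y \<in> ?D" for y
    using right[of "- y"] unfolding has_generator_iff f by (simp_all add: linear_neg[OF lin])
  have inj_on: "inj_on ?f ?D" by (rule inj_on_inverseI[where g = "\<lambda>y. - L y"]) (rule inj)
  have "bij_betw ?f ?D UNIV"
    unfolding bij_betw_def
  proof
    show "?f ` ?D = UNIV" using surj by (metis (no_types, lifting) UNIV_eq_I image_eqI)
  qed (rule inj_on)
  moreover have R: "semigroup_R T (- \<mu>) = (\<lambda>y. - L y)"
    unfolding resolvent_def using inv_into_f_eq[OF inj_on surj(2) surj(1)] by auto
  moreover have "bounded_clinear (\<lambda>y. - L y)"
    using L unfolding bounded_clinear_def
    by (auto intro: bounded_linear_minus simp: bounded_bilinear.minus_right[OF bounded_bilinear_scaleC])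
  ultimately show "- \<mu> \<in> semigroup_rho T" unfolding resolvent_set_def by simp
  show "semigroup_R T (- \<mu>) = (\<lambda>y. - L y)" by (rule R)
qed

text \<open>Dividing \<open>T h (L x) - L x = - orbit_integral h x\<close> by \<open>h\<close> gives
  the first claim; the second follows because \<open>L\<close> is continuous and commutes with
  \<open>T h\<close>.\<close>

lemma improper_integral_inverts_generator:
  assumes L: "\<And>x. ((\<lambda>t. orbit_integral t x) \<longlongrightarrow> L x) at_top" and lin: "bounded_linear L"
  shows "has_generator (L x) (- x)" and "has_generator x y \<Longrightarrow> L y = - x"
proof -
  have T_L: "T h (L x) = L x - orbit_integral h x" if h: "0 \<le> h" for h x
  proof (rule tendsto_unique)
    show "((\<lambda>t. T h (orbit_integral t x)) \<longlongrightarrow> T h (L x)) at_top"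
      by (rule bounded_linear.tendsto[OF T_linear[OF h] L])
    have "filterlim (\<lambda>t. t + h) at_top at_top"
      using filterlim_tendsto_add_at_top[OF tendsto_const[of h] filterlim_ident]
      by (simp add: add.commute)
    then have "((\<lambda>t. orbit_integral (t + h) x - orbit_integral h x) \<longlongrightarrow> L x - orbit_integral h x) at_top"
      using filterlim_compose[OF L[of x]] by (intro tendsto_diff) auto
    moreover have "\<forall>\<^sub>F t in at_top. orbit_integral (t + h) x - orbit_integral h x = T h (orbit_integral t x)"
      using eventually_ge_at_top[of 0] by eventually_elim (simp add: T_orbit_integral(2)[OF h])
    ultimately show "((\<lambda>t. T h (orbit_integral t x)) \<longlongrightarrow> L x - orbit_integral h x) at_top"
      by (rule Lim_transform_eventually)
  qed simp
  have L_T: "L (T h x) = T h (L x)" if h: "0 \<le> h" for h x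
  proof (rule tendsto_unique)
    show "((\<lambda>t. T h (orbit_integral t x)) \<longlongrightarrow> T h (L x)) at_top"
      by (rule bounded_linear.tendsto[OF T_linear[OF h] L])
    have "\<forall>\<^sub>F t in at_top. orbit_integral t (T h x) = T h (orbit_integral t x)"
      using eventually_ge_at_top[of 0] by eventually_elim (simp add: T_orbit_integral(1)[OF h])
    with L[of "T h x"] show "((\<lambda>t. T h (orbit_integral t x)) \<longlongrightarrow> L (T h x)) at_top"
      by (rule Lim_transform_eventually)
  qed simp
  have "((\<lambda>h. - (orbit_integral h x /\<^sub>R h)) \<longlongrightarrow> - x) (at_right 0)"
    by (intro tendsto_minus orbit_integral_average)
  moreover have ev: "\<forall>\<^sub>F h in at_right 0. - (orbit_integral h x /\<^sub>R h) = (T h (L x) - L x) /\<^sub>R h"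
    using eventually_at_right_less[of 0] by eventually_elim (simp add: T_L)
  ultimately show gen: "has_generator (L x) (- x)"
    unfolding has_generator_def by (rule Lim_transform_eventually)
  assume y: "has_generator x y"
  show "L y = - x"
  proof (rule tendsto_unique)
    show "((\<lambda>h. L ((T h x - x) /\<^sub>R h)) \<longlongrightarrow> L y) (at_right 0)"
      using y unfolding has_generator_def by (rule bounded_linear.tendsto[OF lin])
    have "\<forall>\<^sub>F h in at_right 0. (T h (L x) - L x) /\<^sub>R h = L ((T h x - x) /\<^sub>R h)"
      using eventually_at_right_less[of 0]
      by eventually_elim (simp add: L_T linear_scale[OF bounded_linear.linear[OF lin]]
          linear_diff[OF bounded_linear.linear[OF lin]])
    with gen show "((\<lambda>h. L ((T h x - x) /\<^sub>R h)) \<longlongrightarrow> - x) (at_right 0)"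
      unfolding has_generator_def by (rule Lim_transform_eventually)
  qed simp
qed

text \<open>The case of parameter 0 is applied to the rescaled semigroup, and rescaling by
  \<open>- \<mu>\<close> moves the generator back. The bound on truncated integrals passes to the
  limit \<open>L\<close>.\<close>

lemma laplace_resolvent:
  assumes L: "\<And>x. ((\<lambda>t. c0_semigroup.orbit_integral (rescale \<mu> T) t x) \<longlongrightarrow> L x) at_top"
    and bound: "\<And>t x. 0 < t \<Longrightarrow> norm (c0_semigroup.orbit_integral (rescale \<mu> T) t x) \<le> B * norm x"
  shows "- \<mu> \<in> semigroup_rho T" and "0 \<le> B \<Longrightarrow> onorm (semigroup_R T (- \<mu>)) \<le> B"
proof -
  interpret U: c0_semigroup "rescale \<mu> T" by (rule c0_semigroup_rescale) unfold_locales
  have ev: "\<forall>\<^sub>F t in at_top. P t" if "\<And>t. 0 < t \<Longrightarrow> P t" for P :: "real \<Rightarrow> bool"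
    using that eventually_mono[OF eventually_gt_at_top[of 0]] by blast
  have norm_L: "norm (L x) \<le> B * norm x" for x
    by (rule tendsto_upperbound[OF tendsto_norm[OF L]]) (auto intro!: ev bound)
  have lin: "bounded_linear L"
  proof (rule bounded_linear_intro[where K = B])
    show "L (x + y) = L x + L y" for x y
    proof (rule tendsto_unique[OF _ _ tendsto_add[OF L L]])
      show "((\<lambda>t. U.orbit_integral t x + U.orbit_integral t y) \<longlongrightarrow> L (x + y)) at_top"
        by (rule Lim_transform_eventually[OF L[of "x + y"]])
           (auto intro!: ev simp: linear_add[OF bounded_linear.linear[OF U.orbit_integral_linear]])
    qed simp
    show "L (r *\<^sub>R x) = r *\<^sub>R L x" for r x
    proof (rule tendsto_unique[OF _ _ tendsto_scaleR[OF tendsto_const L]])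
      show "((\<lambda>t. r *\<^sub>R U.orbit_integral t x) \<longlongrightarrow> L (r *\<^sub>R x)) at_top"
        by (rule Lim_transform_eventually[OF L[of "r *\<^sub>R x"]])
           (auto intro!: ev simp: linear_scale[OF bounded_linear.linear[OF U.orbit_integral_linear]])
    qed simp
  qed (use norm_L in \<open>simp add: mult.commute\<close>)
  have "L (c *\<^sub>C x) = c *\<^sub>C L x" for c x
  proof (rule tendsto_unique[OF _ _ bounded_bilinear.tendsto[OF bounded_bilinear_scaleC tendsto_const L]])
    have "U.orbit_integral t (c *\<^sub>C x) = c *\<^sub>C U.orbit_integral t x" for t
    proof -
      have "U.orbit_integral t (c *\<^sub>C x) = integral {0..t} ((\<lambda>z. c *\<^sub>C z) \<circ> (\<lambda>s. rescale \<mu> T s x))"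
        unfolding U.orbit_integral_def
        by (intro Henstock_Kurzweil_Integration.integral_cong) (simp add: U.T_scaleC)
      also have "\<dots> = c *\<^sub>C U.orbit_integral t x"
        unfolding U.orbit_integral_def
        by (rule integral_linear[OF U.orbit_integrable[OF order_refl] bounded_linear_scaleC_right])
      finally show ?thesis .
    qed
    then show "((\<lambda>t. c *\<^sub>C U.orbit_integral t x) \<longlongrightarrow> L (c *\<^sub>C x)) at_top"
      using L[of "c *\<^sub>C x"] by simp
  qed simp
  with lin have L': "bounded_clinear L" by (simp add: bounded_clinear_def)
  have right: "has_generator (L y) (\<mu> *\<^sub>C L y - y)" for y
    using has_generator_rescale[OF U.c0_semigroup_axioms U.improper_integral_inverts_generator(1)[OF L lin], of "- \<mu>" y]
    by (simp add: rescale_rescale bounded_bilinear.minus_left[OF bounded_bilinear_scaleC])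
  have left: "L (\<mu> *\<^sub>C x - y) = x" if "has_generator x y" for x y
  proof -
    have "L (y - \<mu> *\<^sub>C x) = - x"
      by (rule U.improper_integral_inverts_generator(2)[OF L lin has_generator_rescale[OF c0_semigroup_axioms that]])
    then show ?thesis
      using linear_neg[OF bounded_linear.linear[OF lin], of "y - \<mu> *\<^sub>C x"] by simp
  qed
  show "- \<mu> \<in> semigroup_rho T" by (rule resolvent_setI(1)[OF L' right left])
  assume "0 \<le> B"
  have "onorm (\<lambda>y. - L y) \<le> B" by (rule onorm_bound[OF \<open>0 \<le> B\<close>]) (simp add: norm_L)
  then show "onorm (semigroup_R T (- \<mu>)) \<le> B"
    by (simp only: resolvent_setI(2)[OF L' right left])
qed

text \<open>The hypothesis bounds the truncated Laplace integrals; their convergence is gained by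
  giving away half of the real part of \<mu> as damping.\<close>

theorem uniformly_kreiss_imp_kreiss:
  assumes "uniformly_kreiss_bounded T"
  shows "kreiss_bounded T"
proof -
  obtain C where C: "\<And>\<alpha> \<beta> t x. 0 < \<alpha> \<Longrightarrow> 0 < t \<Longrightarrow>
      norm (integral {0..t} (\<lambda>s. exp (\<i> * complex_of_real (\<beta> * s)) *\<^sub>C exp (- \<alpha> * s) *\<^sub>R T s x))
        \<le> C * norm x / \<alpha>"
    using assms unfolding uniformly_kreiss_bounded_def by blast
  define C' where "C' = max C 0"
  \<comment> \<open>The frequency \<open>- Im \<mu>\<close> turns the Kreiss integral into an orbit
    integral of the rescaled semigroup; \<open>t = 0\<close> is included for the convergence
    argument.\<close>
  have bound: "norm (c0_semigroup.orbit_integral (rescale \<mu> T) t x) \<le> C' / Re \<mu> * norm x"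
    if "0 < Re \<mu>" "0 \<le> t" for \<mu> t x
  proof (cases "t = 0")
    case True
    interpret U: c0_semigroup "rescale \<mu> T" by (rule c0_semigroup_rescale) unfold_locales
    show ?thesis using True that by (simp add: U.orbit_integral_def C'_def)
  next
    case False
    interpret U: c0_semigroup "rescale \<mu> T" by (rule c0_semigroup_rescale) unfold_locales
    have "exp (\<i> * complex_of_real (- Im \<mu> * s)) *\<^sub>C exp (- Re \<mu> * s) *\<^sub>R T s x = rescale \<mu> T s x" for s
    proof -
      have "\<i> * complex_of_real (- Im \<mu> * s) + complex_of_real (- Re \<mu> * s) = - (\<mu> * complex_of_real s)"
        by (simp add: complex_eq_iff)
      then show ?thesis
        unfolding rescale_def by (simp only: scaleC_scaleR exp_of_real[symmetric] exp_add[symmetric])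
    qed
    then have "norm (U.orbit_integral t x) \<le> C * norm x / Re \<mu>"
      using C[OF that(1), of t "- Im \<mu>" x] that False by (simp add: U.orbit_integral_def)
    also have "\<dots> \<le> C' * norm x / Re \<mu>"
      using that by (intro divide_right_mono mult_right_mono) (auto simp: C'_def)
    finally show ?thesis by simp
  qed
  have main: "- \<mu> \<in> semigroup_rho T \<and> onorm (semigroup_R T (- \<mu>)) \<le> C' / Re \<mu>" if \<mu>: "0 < Re \<mu>" for \<mu>
  proof -
    interpret U: c0_semigroup "rescale \<mu> T" by (rule c0_semigroup_rescale) unfold_locales
    \<comment> \<open>The integrals at \<nu> are bounded because \<nu> still has positive real part;
      the remaining factor \<open>exp (- \<delta> * s)\<close> makes those at \<mu>
      converge.\<close>
    define \<delta> where "\<delta> = Re \<mu> / 2"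
    define \<nu> where "\<nu> = \<mu> - complex_of_real \<delta>"
    interpret V: c0_semigroup "rescale \<nu> T" by (rule c0_semigroup_rescale) unfold_locales
    have \<delta>: "0 < \<delta>" "0 < Re \<nu>" using \<mu> by (auto simp: \<delta>_def \<nu>_def)
    have U_V: "rescale \<mu> T = rescale (complex_of_real \<delta>) (rescale \<nu> T)"
      by (simp add: rescale_rescale \<nu>_def)
    have "\<exists>l. ((\<lambda>t. U.orbit_integral t x) \<longlongrightarrow> l) at_top" for x
    proof -
      obtain l where "((\<lambda>t. integral {0..t} (\<lambda>s. exp (- \<delta> * s) *\<^sub>R rescale \<nu> T s x)) \<longlongrightarrow> l) at_top"
        by (rule exp_weight_integral_convergent[OF V.orbit_continuous \<delta>(1), of x "C' / Re \<nu> * norm x"])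
           (use bound[OF \<delta>(2)] in \<open>auto simp: V.orbit_integral_def\<close>)
      then show ?thesis unfolding U.orbit_integral_def unfolding U_V rescale_of_real by blast
    qed
    then obtain L where L: "\<And>x. ((\<lambda>t. U.orbit_integral t x) \<longlongrightarrow> L x) at_top" by metis
    show ?thesis
      using laplace_resolvent[OF L, of "C' / Re \<mu>"] bound[OF \<mu>] \<mu> by (auto simp: C'_def)
  qed
  show ?thesis
    unfolding kreiss_bounded_def
  proof (intro conjI exI allI impI subsetI)
    fix \<mu> assume "\<mu> \<in> {\<mu>. Re \<mu> < 0}"
    then show "\<mu> \<in> semigroup_rho T" using main[of "- \<mu>"] by simp
  qed (use main in blast)
qed

theorem kreiss_imp_abel:
  assumes "kreiss_bounded T"
  shows "abel_bounded T"
proof -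
  obtain C where C: "\<And>\<mu>. 0 < Re \<mu> \<Longrightarrow> onorm (semigroup_R T (- \<mu>)) \<le> C / Re \<mu>"
    using assms unfolding kreiss_bounded_def by blast
  have "onorm (semigroup_R T (- complex_of_real \<mu>)) \<le> C / \<mu>" if "0 < \<mu>" for \<mu>
    using C[of "complex_of_real \<mu>"] that by simp
  moreover have "complex_of_real ` {..<0} \<subseteq> semigroup_rho T"
    using assms unfolding kreiss_bounded_def by auto
  ultimately show ?thesis unfolding abel_bounded_def by blast
qed

end

section \<open>Positive orbits\<close>

context c0_semigroup
begin

section \<open>The cone of positive orbits and linear growth on it\<close>

definition positive_orbits :: "'a complexification set" where
  "positive_orbits = {y. \<forall>s\<ge>0. T s y \<in> positive_cone}"

lemma positive_orbits_cone:
  shows "closed positive_orbits" "0 \<in> positive_orbits"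
    and "x \<in> positive_orbits \<Longrightarrow> y \<in> positive_orbits \<Longrightarrow> x + y \<in> positive_orbits"
    and "0 \<le> r \<Longrightarrow> x \<in> positive_orbits \<Longrightarrow> r *\<^sub>R x \<in> positive_orbits"
    and "0 \<le> s \<Longrightarrow> x \<in> positive_orbits \<Longrightarrow> T s x \<in> positive_orbits"
proof -
  have "positive_orbits = (\<Inter>s\<in>{0..}. T s -` positive_cone)"
    by (auto simp: positive_orbits_def)
  moreover have "closed (T s -` positive_cone)" if "0 \<le> s" for s
    by (intro closed_vimage closed_positive_cone linear_continuous_on T_linear that)
  ultimately show "closed positive_orbits" by auto
qed (auto simp: positive_orbits_def linear_0[OF bounded_linear.linear[OF T_linear]]
    linear_add[OF bounded_linear.linear[OF T_linear]]
    linear_scale[OF bounded_linear.linear[OF T_linear]] T_add[symmetric]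
    positive_cone_zero positive_cone_add positive_cone_scaleR)

lemma integral_positive_orbits:
  fixes u :: "real \<Rightarrow> 'a complexification"
  assumes "u integrable_on {a..b}" "\<And>s. s \<in> {a..b} \<Longrightarrow> u s \<in> positive_orbits"
  shows "integral {a..b} u \<in> positive_orbits"
  by (rule integral_closed_convex_cone[OF assms positive_orbits_cone(1-4)])

definition linear_integral_growth :: bool where
  "linear_integral_growth \<longleftrightarrow> (\<forall>y\<in>positive_orbits. \<exists>M. \<forall>t\<ge>0. norm (orbit_integral t y) \<le> M * t)"

lemma cesaro_imp_linear_integral_growth:
  assumes "cesaro_bounded T"
  shows "linear_integral_growth"
  unfolding linear_integral_growth_def
proof (intro ballI)
  fix y
  obtain C where C: "\<And>t. 0 < t \<Longrightarrow> (1 / t) * norm (integral {0..t} (\<lambda>s. T s y)) \<le> C * norm y"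
    using assms unfolding cesaro_bounded_def by blast
  have "norm (orbit_integral t y) \<le> (C * norm y) * t" if "0 \<le> t" for t
    using C[of t] that unfolding orbit_integral_def by (cases "t = 0") (auto simp: field_simps)
  then show "\<exists>M. \<forall>t\<ge>0. norm (orbit_integral t y) \<le> M * t" by blast
qed

text \<open>The resolvent is propagated from large \<open>\<mu>\<close>, where it is a Laplace integral, down to all
  \<open>\<mu> > 0\<close>: the Abel bound makes the Neumann series converge on a step of fixed relative length.\<close>

lemma resolvent_positive_orbits:
  assumes rho: "\<And>\<mu>. 0 < \<mu> \<Longrightarrow> - complex_of_real \<mu> \<in> semigroup_rho T"
    and C: "0 < C" "\<And>\<mu> y. 0 < \<mu> \<Longrightarrow> norm (semigroup_R T (- complex_of_real \<mu>) y) \<le> C / \<mu> * norm y"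
    and "0 < \<mu>" "y \<in> positive_orbits"
  shows "- semigroup_R T (- complex_of_real \<mu>) y \<in> positive_orbits"
proof -
  \<comment> \<open>The sign makes \<open>R \<mu>\<close> the inverse of \<open>\<mu> + A\<close>,
    the operator that preserves \<open>positive_orbits\<close>.\<close>
  define R where "R \<mu> y = - semigroup_R T (- complex_of_real \<mu>) y" for \<mu> y
  have gen: "has_generator (- R \<mu> y) (y - \<mu> *\<^sub>R R \<mu> y)" if "0 < \<mu>" for \<mu> y
    using resolvent_equation(1)[OF rho[OF that], of y] by (simp add: R_def scaleC_of_real)
  have uniq: "z = - R \<mu> y" if "0 < \<mu>" "has_generator z (y + \<mu> *\<^sub>R z)" for \<mu> y z
    using resolvent_equation(2)[OF rho[OF that(1)], of z y] that(2) by (simp add: R_def scaleC_of_real)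
  have R_lin: "bounded_linear (R \<mu>)" if "0 < \<mu>" for \<mu>
    using rho[OF that] unfolding R_def resolvent_set_def bounded_clinear_def
    by (auto intro: bounded_linear_minus)
  have R_norm: "norm (R \<mu> y) \<le> C / \<mu> * norm y" if "0 < \<mu>" for \<mu> y
    using C(2)[OF that] unfolding R_def norm_minus_cancel .
  \<comment> \<open>The resolvent identity, read as a fixed point equation for
    \<open>R \<mu> y\<close> in terms of the operator at \<nu>.\<close>
  have identity: "R \<mu> y = R \<nu> (y + (\<nu> - \<mu>) *\<^sub>R R \<mu> y)" if "0 < \<mu>" "0 < \<nu>" for \<mu> \<nu> y
    using uniq[OF that(2), of "- R \<mu> y" "y + (\<nu> - \<mu>) *\<^sub>R R \<mu> y"] gen[OF that(1), of y]
    by (simp add: algebra_simps)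
  obtain M \<omega> where M: "1 \<le> M" "0 \<le> \<omega>"
    and growth: "\<And>t x. 0 \<le> t \<Longrightarrow> norm (T t x) \<le> M * exp (\<omega> * t) * norm x"
    using exponential_bound by blast
  \<comment> \<open>Beyond the growth exponent the Laplace integral converges, so
    \<open>R \<mu> y\<close> is a limit of integrals with values in the closed cone.\<close>
  have large: "R \<mu> y \<in> positive_orbits" if "\<omega> + 1 \<le> \<mu>" and y: "y \<in> positive_orbits" for \<mu> y
  proof -
    have \<mu>: "0 < \<mu>" using that M by simp
    interpret U: c0_semigroup "rescale (complex_of_real \<mu>) T"
      by (rule c0_semigroup_rescale) unfold_locales
    have "U.has_generator (- R \<mu> y) y"
      using has_generator_rescale[OF c0_semigroup_axioms gen[OF \<mu>, of y], of "complex_of_real \<mu>"]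
      by (simp add: scaleC_of_real)
    from U.has_generator_orbit_integral[OF this]
    have orbit: "U.orbit_integral t y = exp (- \<mu> * t) *\<^sub>R T t (- R \<mu> y) + R \<mu> y" if "0 \<le> t" for t
      using that by (simp add: rescale_of_real)
    have "((\<lambda>t. exp (- \<mu> * t) *\<^sub>R T t (- R \<mu> y)) \<longlongrightarrow> 0) at_top"
    proof (rule Lim_null_comparison)
      show "\<forall>\<^sub>F t in at_top. norm (exp (- \<mu> * t) *\<^sub>R T t (- R \<mu> y)) \<le> M * norm (R \<mu> y) * exp (- t)"
        using eventually_ge_at_top[of 0]
      proof eventually_elim
        case (elim t)
        have "norm (exp (- \<mu> * t) *\<^sub>R T t (- R \<mu> y)) \<le> exp (- \<mu> * t) * (M * exp (\<omega> * t) * norm (R \<mu> y))"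
          using growth[OF elim, of "- R \<mu> y"] by simp
        also have "\<dots> = M * norm (R \<mu> y) * exp ((\<omega> - \<mu>) * t)"
          by (simp add: exp_diff exp_minus field_simps)
        also have "\<dots> \<le> M * norm (R \<mu> y) * exp (- t)"
          using M that(1) elim mult_right_mono[of "\<omega> + 1" \<mu> t]
          by (intro mult_left_mono) (auto simp: algebra_simps)
        finally show ?case .
      qed
      have "((\<lambda>t::real. exp (- t)) \<longlongrightarrow> 0) at_top"
        by (rule filterlim_compose[OF exp_at_bot filterlim_uminus_at_bot_at_top])
      then show "((\<lambda>t. M * norm (R \<mu> y) * exp (- t)) \<longlongrightarrow> 0) at_top"
        by (rule tendsto_mult_right_zero)
    qed
    from tendsto_add[OF this tendsto_const[of "R \<mu> y"]]
    have "((\<lambda>t. exp (- \<mu> * t) *\<^sub>R T t (- R \<mu> y) + R \<mu> y) \<longlongrightarrow> R \<mu> y) at_top" by simp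
    then show ?thesis
    proof (rule Lim_in_closed_set[rotated 3])
      show "\<forall>\<^sub>F t in at_top. exp (- \<mu> * t) *\<^sub>R T t (- R \<mu> y) + R \<mu> y \<in> positive_orbits"
        using eventually_ge_at_top[of 0]
      proof eventually_elim
        case (elim t)
        have "U.orbit_integral t y \<in> positive_orbits"
          unfolding U.orbit_integral_def
          by (rule integral_positive_orbits[OF U.orbit_integrable[OF order_refl]])
             (auto simp: rescale_of_real intro!: positive_orbits_cone y)
        then show ?case by (simp only: orbit[OF elim])
      qed
    qed (simp_all add: positive_orbits_cone)
  qed
  define K where "K = max C 1"
  have K: "1 \<le> K" "C \<le> K" by (auto simp: K_def)
  \<comment> \<open>With \<open>\<mu> = q * \<nu>\<close> the gap \<open>\<nu> - \<mu>\<close> is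
    \<open>\<nu> / (2 * K)\<close>, so \<open>C / \<nu>\<close> times the gap is at most 1/2,
    independently of \<nu>.\<close>
  define q where "q = 1 - 1 / (2 * K)"
  have q: "0 < q" "q < 1" using K by (auto simp: q_def field_simps)
  have steps: "R \<mu> y \<in> positive_orbits"
    if "0 < \<mu>" "q ^ n * (\<omega> + 1) \<le> \<mu>" "y \<in> positive_orbits" for n \<mu> y
    using that
  proof (induction n arbitrary: \<mu> y)
    case 0
    then show ?case by (intro large) auto
  next
    case (Suc n)
    define \<nu> where "\<nu> = \<mu> / q"
    have \<nu>: "0 < \<nu>" "q ^ n * (\<omega> + 1) \<le> \<nu>" "\<mu> = q * \<nu>"
      using Suc.prems q by (auto simp: \<nu>_def field_simps)
    have d: "\<nu> - \<mu> = \<nu> / (2 * K)" using K by (simp add: \<nu>(3) q_def field_simps)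
    \<comment> \<open>Partial sums of the Neumann series, written as fixed point iterates from 0;
      they stay in the cone because \<open>\<nu> - \<mu>\<close> is nonnegative.\<close>
    define z where "z n = ((\<lambda>z. R \<nu> (y + (\<nu> - \<mu>) *\<^sub>R z)) ^^ n) 0" for n
    have z_Suc: "z (Suc n) = R \<nu> (y + (\<nu> - \<mu>) *\<^sub>R z n)" for n by (simp add: z_def)
    have z_pos: "z m \<in> positive_orbits" for m
    proof (induction m)
      case 0
      then show ?case by (simp add: z_def positive_orbits_cone)
    next
      case (Suc m)
      then show ?case
        unfolding z_Suc using \<open>y \<in> positive_orbits\<close> K \<nu>(1)
        by (intro Suc.IH \<open>\<And>\<mu> y. 0 < \<mu> \<Longrightarrow> q ^ n * (\<omega> + 1) \<le> \<mu> \<Longrightarrow> y \<in> positive_orbits \<Longrightarrow> R \<mu> y \<in> positive_orbits\<close>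
            \<nu> positive_orbits_cone) (auto simp: d)
    qed
    \<comment> \<open>Since \<open>R \<mu> y\<close> is the fixed point, each iteration at least
      halves the distance to it.\<close>
    have z_err: "norm (z m - R \<mu> y) \<le> (1 / 2) ^ m * norm (R \<mu> y)" for m
    proof (induction m)
      case 0
      then show ?case by (simp add: z_def)
    next
      case (Suc m)
      have "z (Suc m) - R \<mu> y = R \<nu> (y + (\<nu> - \<mu>) *\<^sub>R z m) - R \<nu> (y + (\<nu> - \<mu>) *\<^sub>R R \<mu> y)"
        using identity[OF \<open>0 < \<mu>\<close> \<nu>(1), of y] by (simp only: z_Suc)
      also have "\<dots> = R \<nu> ((\<nu> - \<mu>) *\<^sub>R (z m - R \<mu> y))"
        by (simp add: linear_diff[OF bounded_linear.linear[OF R_lin[OF \<nu>(1)]], symmetric] scaleR_diff_right)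
      finally have "norm (z (Suc m) - R \<mu> y) \<le> C / \<nu> * norm ((\<nu> - \<mu>) *\<^sub>R (z m - R \<mu> y))"
        by (simp only: R_norm[OF \<nu>(1)])
      also have "\<dots> = C / (2 * K) * norm (z m - R \<mu> y)"
        using \<nu>(1) K by (simp add: d)
      also have "\<dots> \<le> 1 / 2 * norm (z m - R \<mu> y)"
        using K by (intro mult_right_mono) (auto simp: field_simps)
      also have "\<dots> \<le> 1 / 2 * ((1 / 2) ^ m * norm (R \<mu> y))" by (intro mult_left_mono Suc.IH) auto
      finally show ?case by simp
    qed
    have "(\<lambda>m. (1 / 2) ^ m * norm (R \<mu> y)) \<longlonglongrightarrow> 0"
      by (intro tendsto_mult_left_zero LIMSEQ_realpow_zero) auto
    then have "(\<lambda>m. z m - R \<mu> y) \<longlonglongrightarrow> 0"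
      by (rule Lim_null_comparison[rotated]) (simp add: z_err)
    then have "z \<longlonglongrightarrow> R \<mu> y" by (rule Lim_null[THEN iffD2])
    then show ?case
      by (rule Lim_in_closed_set[rotated 3]) (simp_all add: positive_orbits_cone z_pos)
  qed
  \<comment> \<open>Geometric descent from \<open>\<omega> + 1\<close> falls below every positive
    \<mu> after finitely many steps.\<close>
  have "(\<lambda>n. q ^ n * (\<omega> + 1)) \<longlonglongrightarrow> 0"
    using q by (intro tendsto_mult_left_zero LIMSEQ_realpow_zero) auto
  then have "\<forall>\<^sub>F n in sequentially. q ^ n * (\<omega> + 1) < \<mu>" using \<open>0 < \<mu>\<close> by (rule order_tendstoD)
  then obtain n where "q ^ n * (\<omega> + 1) < \<mu>" by (auto simp: eventually_sequentially)
  then show ?thesis using steps[of \<mu> n y] assms(4,5) by (simp add: R_def)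
qed

lemma abel_imp_linear_integral_growth:
  assumes "abel_bounded T"
  shows "linear_integral_growth"
proof -
  have rho: "- complex_of_real \<mu> \<in> semigroup_rho T" if "0 < \<mu>" for \<mu>
    using assms that unfolding abel_bounded_def
    by (metis (no_types, lifting) image_subset_iff lessThan_iff neg_less_0_iff_less of_real_minus)
  obtain C where C: "\<And>\<mu>. 0 < \<mu> \<Longrightarrow> onorm (semigroup_R T (- complex_of_real \<mu>)) \<le> C / \<mu>"
    using assms unfolding abel_bounded_def by blast
  define C' where "C' = max C 1"
  have bound: "norm (semigroup_R T (- complex_of_real \<mu>) y) \<le> C' / \<mu> * norm y" if "0 < \<mu>" for \<mu> y
  proof -
    have "bounded_linear (semigroup_R T (- complex_of_real \<mu>))"
      using rho[OF that] unfolding resolvent_set_def bounded_clinear_def by auto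
    from onorm[OF this, of y] have "norm (semigroup_R T (- complex_of_real \<mu>) y)
      \<le> onorm (semigroup_R T (- complex_of_real \<mu>)) * norm y" .
    also have "\<dots> \<le> C / \<mu> * norm y" by (intro mult_right_mono C that) auto
    also have "\<dots> \<le> C' / \<mu> * norm y"
      using that by (intro mult_right_mono divide_right_mono) (auto simp: C'_def)
    finally show ?thesis .
  qed
  have C': "0 < C'" by (simp add: C'_def)
  show ?thesis
    unfolding linear_integral_growth_def
  proof (intro ballI exI allI impI)
    fix y and t :: real assume y: "y \<in> positive_orbits" and "0 \<le> t"
    show "norm (orbit_integral t y) \<le> (exp 1 * C' * norm y) * t"
    proof (cases "t = 0")
      case True
      then show ?thesis by (simp add: orbit_integral_def)
    next
      case False
      then have t: "0 < t" using \<open>0 \<le> t\<close> by simp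
      \<comment> \<open>At this scale the weight stays above \<open>exp (-1)\<close> on
        \<open>{0..t}\<close> while the Abel bound \<open>C' / \<mu>\<close> is linear in
        \<open>t\<close>.\<close>
      define \<mu> where "\<mu> = 1 / t"
      have \<mu>: "0 < \<mu>" using t by (simp add: \<mu>_def)
      interpret U: c0_semigroup "rescale (complex_of_real \<mu>) T"
        by (rule c0_semigroup_rescale) unfold_locales
      \<comment> \<open>The sign convention makes this the negative of the inverse of
        \<open>\<mu> + A\<close> at \<open>y\<close>, so it is \<open>- z\<close> that lies in the
        cone.\<close>
      define z where "z = semigroup_R T (- complex_of_real \<mu>) y"
      have z: "- z \<in> positive_orbits"
        unfolding z_def by (rule resolvent_positive_orbits[OF rho C' bound \<mu> y])
      have "U.has_generator z y"
        using has_generator_rescale[OF c0_semigroup_axioms resolvent_equation(1)[OF rho[OF \<mu>], of y],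
            of "complex_of_real \<mu>"]
        by (simp add: z_def)
      from U.has_generator_orbit_integral[OF this \<open>0 \<le> t\<close>]
      have orbit: "U.orbit_integral t y = exp (- \<mu> * t) *\<^sub>R T t z - z"
        by (simp add: rescale_of_real)
      have pos: "U.orbit_integral t y \<in> positive_cone"
        unfolding U.orbit_integral_def
        by (rule integral_positive_cone[OF U.orbit_integrable[OF order_refl]])
           (use y in \<open>auto simp: rescale_of_real positive_orbits_def intro!: positive_cone_scaleR\<close>)
      \<comment> \<open>The part cut off by truncation is itself positive, so \<open>- z\<close>
        dominates the truncated Laplace integral.\<close>
      have "- z - U.orbit_integral t y = exp (- \<mu> * t) *\<^sub>R T t (- z)"
        using \<open>0 \<le> t\<close> by (simp add: orbit linear_neg[OF bounded_linear.linear[OF T_linear]])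
      also have "\<dots> \<in> positive_cone"
        using z \<open>0 \<le> t\<close> by (auto simp: positive_orbits_def intro!: positive_cone_scaleR)
      finally have U_le: "norm (U.orbit_integral t y) \<le> norm (- z)"
        by (rule norm_mono_positive_cone[OF pos])
      have "norm (orbit_integral t y) \<le> norm (exp 1 *\<^sub>R U.orbit_integral t y)"
      proof (rule norm_mono_positive_cone)
        show "orbit_integral t y \<in> positive_cone"
          unfolding orbit_integral_def
          by (rule integral_positive_cone[OF orbit_integrable[OF order_refl]])
             (use y in \<open>auto simp: positive_orbits_def\<close>)
        \<comment> \<open>Multiplying by \<open>exp 1\<close> lifts the weight to at least 1 on
          \<open>{0..t}\<close>, which removes it at the cost of a constant.\<close>
        have "exp 1 *\<^sub>R U.orbit_integral t y - orbit_integral t y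
            = integral {0..t} (\<lambda>s. exp 1 *\<^sub>R rescale (complex_of_real \<mu>) T s y - T s y)"
          unfolding U.orbit_integral_def orbit_integral_def
          by (simp add: Henstock_Kurzweil_Integration.integral_diff integrable_cmul
              U.orbit_integrable orbit_integrable)
        also have "\<dots> = integral {0..t} (\<lambda>s. (exp (1 - \<mu> * s) - 1) *\<^sub>R T s y)"
          by (simp add: rescale_of_real exp_diff exp_minus divide_inverse algebra_simps)
        also have "\<dots> \<in> positive_cone"
        proof (rule integral_positive_cone)
          show "(\<lambda>s. (exp (1 - \<mu> * s) - 1) *\<^sub>R T s y) integrable_on {0..t}"
            by (intro integrable_continuous_real continuous_intros orbit_continuous_Icc) auto
          fix s assume s: "s \<in> {0..t}"
          then have "\<mu> * s \<le> 1" using t by (simp add: \<mu>_def)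
          then show "(exp (1 - \<mu> * s) - 1) *\<^sub>R T s y \<in> positive_cone"
            using y s by (intro positive_cone_scaleR) (auto simp: positive_orbits_def)
        qed
        finally show "exp 1 *\<^sub>R U.orbit_integral t y - orbit_integral t y \<in> positive_cone" .
      qed
      also have "\<dots> \<le> exp 1 * norm z" using U_le by simp
      also have "\<dots> \<le> exp 1 * (C' / \<mu> * norm y)"
        unfolding z_def by (intro mult_left_mono bound \<mu>) auto
      finally show ?thesis by (simp add: \<mu>_def mult.assoc mult.commute mult.left_commute)
    qed
  qed
qed

end

section \<open>Integrals of functionals along orbits\<close>

context c0_semigroup
begin

text \<open>For fixed \<phi> and nonnegative \<open>t\<close> this is a seminorm in
  \<open>x\<close>, the form to which uniform boundedness is applied.\<close>

definition functional_integral ::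
    "('a complexification \<Rightarrow> complex) \<Rightarrow> real \<Rightarrow> 'a complexification \<Rightarrow> real" where
  "functional_integral \<phi> t x = integral {0..t} (\<lambda>s. cmod (\<phi> (T s x)))"

lemma functional_orbit_continuous:
  assumes "\<phi> \<in> dual_space" "0 \<le> a"
  shows "continuous_on {a..b} (\<lambda>s. \<phi> (T s x))"
  using assms by (intro bounded_linear.continuous_on[of \<phi>] orbit_continuous_Icc) (auto simp: dual_space_def)

lemma functional_integrable:
  assumes "\<phi> \<in> dual_space" "0 \<le> a"
  shows "(\<lambda>s. cmod (\<phi> (T s x))) integrable_on {a..b}"
  by (intro integrable_continuous_real continuous_on_norm functional_orbit_continuous assms)

lemma functional_integral_add:
  assumes "\<phi> \<in> dual_space"
  shows "functional_integral \<phi> t (x + y) \<le> functional_integral \<phi> t x + functional_integral \<phi> t y"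
proof -
  have lin: "linear \<phi>" using assms by (auto simp: dual_space_def bounded_linear.linear)
  have "functional_integral \<phi> t (x + y) \<le> integral {0..t} (\<lambda>s. cmod (\<phi> (T s x)) + cmod (\<phi> (T s y)))"
    unfolding functional_integral_def
    by (intro integral_le integrable_add functional_integrable assms order_refl)
       (simp add: linear_add[OF bounded_linear.linear[OF T_linear]] linear_add[OF lin] norm_triangle_ineq)
  then show ?thesis
    by (simp add: functional_integral_def Henstock_Kurzweil_Integration.integral_add
        functional_integrable assms)
qed

lemma functional_integral_scaleC:
  assumes "\<phi> \<in> dual_space"
  shows "functional_integral \<phi> t (c *\<^sub>C x) = cmod c * functional_integral \<phi> t x"
proof -
  have hom: "\<phi> (c *\<^sub>C x) = c * \<phi> x" for c x using assms by (auto simp: dual_space_def)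
  have "functional_integral \<phi> t (c *\<^sub>C x) = integral {0..t} (\<lambda>s. cmod c * cmod (\<phi> (T s x)))"
    unfolding functional_integral_def
    by (intro Henstock_Kurzweil_Integration.integral_cong) (simp add: T_scaleC hom norm_mult)
  then show ?thesis by (simp add: functional_integral_def)
qed

text \<open>Controls the initial stretch before an orbit becomes positive, and yields continuity in
  \<open>x\<close>. It comes from local boundedness alone.\<close>

lemma functional_integral_bound:
  assumes "0 \<le> t"
  obtains M where "1 \<le> M"
    "\<And>\<phi> x s. \<phi> \<in> dual_space \<Longrightarrow> 0 \<le> s \<Longrightarrow> s \<le> t \<Longrightarrow> functional_integral \<phi> s x \<le> M * norm x * onorm \<phi> * s"
proof -
  obtain M where M: "1 \<le> M" and bound: "\<And>s x. 0 \<le> s \<Longrightarrow> s \<le> t \<Longrightarrow> norm (T s x) \<le> M * norm x"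
    using locally_bounded[of t] by blast
  show thesis
  proof (rule that[OF M])
    fix \<phi> :: "'a complexification \<Rightarrow> complex" and x s
    assume \<phi>: "\<phi> \<in> dual_space" and s: "0 \<le> s" "s \<le> t"
    have lin: "bounded_linear \<phi>" using \<phi> by (simp add: dual_space_def)
    have "norm (functional_integral \<phi> s x) \<le> (M * norm x * onorm \<phi>) * (s - 0)"
      unfolding functional_integral_def
    proof (rule integral_bound[OF s(1)])
      show "continuous_on {0..s} (\<lambda>s. cmod (\<phi> (T s x)))"
        by (intro continuous_on_norm functional_orbit_continuous \<phi> order_refl)
      fix r assume r: "r \<in> {0..s}"
      have "cmod (\<phi> (T r x)) \<le> onorm \<phi> * norm (T r x)" by (rule onorm[OF lin])
      also have "\<dots> \<le> onorm \<phi> * (M * norm x)"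
        using r s by (intro mult_left_mono bound onorm_pos_le lin) auto
      finally show "norm (cmod (\<phi> (T r x))) \<le> M * norm x * onorm \<phi>" by (simp add: mult.commute)
    qed
    then show "functional_integral \<phi> s x \<le> M * norm x * onorm \<phi> * s"
      by simp
  qed
qed

text \<open>A subadditive function bounded above by a multiple of the norm is Lipschitz.\<close>

lemma functional_integral_continuous:
  assumes \<phi>: "\<phi> \<in> dual_space" and t: "0 \<le> t"
  shows "continuous_on UNIV (functional_integral \<phi> t)"
proof -
  obtain M where M: "1 \<le> M"
    and bound: "\<And>x. functional_integral \<phi> t x \<le> M * norm x * onorm \<phi> * t"
    using functional_integral_bound[OF t] \<phi> t by (metis order_refl)
  have "(M * onorm \<phi> * t)-lipschitz_on UNIV (functional_integral \<phi> t)"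
  proof (rule lipschitz_onI)
    fix x y
    have diff: "functional_integral \<phi> t x - functional_integral \<phi> t y \<le> M * onorm \<phi> * t * norm (x - y)" for x y
      using functional_integral_add[OF \<phi>, of t y "x - y"] bound[of "x - y"]
      by (simp add: mult.commute mult.left_commute)
    show "dist (functional_integral \<phi> t x) (functional_integral \<phi> t y) \<le> M * onorm \<phi> * t * dist x y"
      using diff[of x y] diff[of y x] by (simp add: dist_real_def dist_norm norm_minus_commute abs_le_iff)
  next
    show "0 \<le> M * onorm \<phi> * t"
      using M t \<phi> by (auto simp: dual_space_def onorm_pos_le)
  qed
  then show ?thesis by (rule lipschitz_on_continuous_on)
qed

text \<open>For one \<open>x\<close> the bound is uniform in \<phi> and \<open>t\<close>, as uniform
  boundedness requires. Vectors with such a bound are closed under sums and complex multiples, so it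
  suffices to treat the positive cone.\<close>

lemma functional_integral_pointwise:
  assumes pos: "individually_eventually_positive T" and growth: "linear_integral_growth"
  shows "\<exists>M\<ge>0. \<forall>\<phi>\<in>dual_space. \<forall>t\<ge>0. functional_integral \<phi> t x \<le> M * onorm \<phi> * t"
proof -
  let ?P = "\<lambda>x. \<exists>M\<ge>0. \<forall>\<phi>\<in>dual_space. \<forall>t\<ge>0. functional_integral \<phi> t x \<le> M * onorm \<phi> * t"
  have add: "?P (x + y)" if x: "?P x" and y: "?P y" for x y
  proof -
    obtain M N where "0 \<le> M" "0 \<le> N"
      and M: "\<And>\<phi> t. \<phi> \<in> dual_space \<Longrightarrow> 0 \<le> t \<Longrightarrow> functional_integral \<phi> t x \<le> M * onorm \<phi> * t"
      and N: "\<And>\<phi> t. \<phi> \<in> dual_space \<Longrightarrow> 0 \<le> t \<Longrightarrow> functional_integral \<phi> t y \<le> N * onorm \<phi> * t"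
      using x y by blast
    have "functional_integral \<phi> t (x + y) \<le> (M + N) * onorm \<phi> * t" if "\<phi> \<in> dual_space" "0 \<le> t" for \<phi> t
      using functional_integral_add[OF that(1), of t x y] M[OF that] N[OF that] by (simp add: algebra_simps)
    then show ?thesis using \<open>0 \<le> M\<close> \<open>0 \<le> N\<close> by (intro exI[of _ "M + N"]) auto
  qed
  have scale: "?P (c *\<^sub>C x)" if x: "?P x" for c x
  proof -
    obtain M where "0 \<le> M"
      and M: "\<And>\<phi> t. \<phi> \<in> dual_space \<Longrightarrow> 0 \<le> t \<Longrightarrow> functional_integral \<phi> t x \<le> M * onorm \<phi> * t"
      using x by blast
    have "functional_integral \<phi> t (c *\<^sub>C x) \<le> (cmod c * M) * onorm \<phi> * t" if "\<phi> \<in> dual_space" "0 \<le> t" for \<phi> t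
      using mult_left_mono[OF M[OF that], of "cmod c"]
      by (simp add: functional_integral_scaleC[OF that(1)] mult.assoc)
    then show ?thesis using \<open>0 \<le> M\<close> by (intro exI[of _ "cmod c * M"]) auto
  qed
  have cone: "?P x" if x: "x \<in> positive_cone" for x
  proof -
    obtain \<tau> where \<tau>: "0 \<le> \<tau>" "\<And>t. \<tau> \<le> t \<Longrightarrow> T t x \<in> positive_cone"
      using pos x unfolding individually_eventually_positive_def by blast
    define y where "y = T \<tau> x"
    have y: "y \<in> positive_orbits"
      unfolding positive_orbits_def y_def using \<tau> by (auto simp: T_add[symmetric])
    then obtain M where M: "\<And>t. 0 \<le> t \<Longrightarrow> norm (orbit_integral t y) \<le> M * t"
      using growth unfolding linear_integral_growth_def by blast
    obtain N where N: "1 \<le> N" "\<And>\<phi> x s. \<phi> \<in> dual_space \<Longrightarrow> 0 \<le> s \<Longrightarrow> s \<le> \<tau> \<Longrightarrow>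
        functional_integral \<phi> s x \<le> N * norm x * onorm \<phi> * s"
      using functional_integral_bound[OF \<tau>(1)] by blast
    \<comment> \<open>\<open>N\<close> covers \<open>{0..\<tau>}\<close>, where the orbit may fail
      to be positive, and \<open>M\<close> covers the later times.\<close>
    define B where "B = N * norm x + max M 0"
    have "functional_integral \<phi> t x \<le> B * onorm \<phi> * t" if \<phi>: "\<phi> \<in> dual_space" and t: "0 \<le> t" for \<phi> t
    proof -
      have on: "0 \<le> onorm \<phi>" using \<phi> by (auto simp: dual_space_def onorm_pos_le)
      have NB: "N * norm x * onorm \<phi> * s \<le> N * norm x * onorm \<phi> * t" if "s \<le> t" for s
        using that N on by (intro mult_left_mono) auto
      show ?thesis
      proof (cases "t \<le> \<tau>")
        case True
        have "N * norm x * onorm \<phi> * t \<le> B * onorm \<phi> * t"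
          using on t by (intro mult_right_mono) (auto simp: B_def)
        then show ?thesis using N(2)[OF \<phi> t True, of x] by linarith
      next
        case False
        have "functional_integral \<phi> t x = functional_integral \<phi> \<tau> x + integral {\<tau>..t} (\<lambda>s. cmod (\<phi> (T s x)))"
          unfolding functional_integral_def using \<tau>(1) False
          by (intro Henstock_Kurzweil_Integration.integral_combine[symmetric] functional_integrable \<phi>) auto
        also have "integral {\<tau>..t} (\<lambda>s. cmod (\<phi> (T s x)))
            = integral {0..t - \<tau>} ((\<lambda>s. cmod (\<phi> (T s x))) \<circ> (+) \<tau>)"
          using integral_shift_Icc_real[of 0 "t - \<tau>" "\<lambda>s. cmod (\<phi> (T s x))" \<tau>] by simp
        also have "\<dots> = integral {0..t - \<tau>} (\<lambda>s. cmod (\<phi> (T s y)))"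
          by (intro Henstock_Kurzweil_Integration.integral_cong)
             (use \<tau>(1) in \<open>auto simp: y_def T_add[symmetric] add.commute\<close>)
        \<comment> \<open>Positivity of the orbit of \<open>y\<close> lets the absolute value be
          taken outside the integral.\<close>
        also have "\<dots> \<le> onorm \<phi> * norm (integral {0..t - \<tau>} (\<lambda>s. T s y))"
          using y by (intro integral_functional_positive_cone_le orbit_continuous_Icc \<phi>)
            (auto simp: positive_orbits_def)
        also have "\<dots> \<le> onorm \<phi> * (max M 0 * t)"
        proof (intro mult_left_mono on)
          have "M * (t - \<tau>) \<le> max M 0 * t"
            using False \<tau>(1) t by (intro mult_mono) auto
          then show "norm (integral {0..t - \<tau>} (\<lambda>s. T s y)) \<le> max M 0 * t"
            using M[of "t - \<tau>"] False by (simp add: orbit_integral_def)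
        qed
        finally show ?thesis
          using N(2)[OF \<phi> \<tau>(1) order_refl, of x] NB[of \<tau>] False by (simp add: B_def algebra_simps)
      qed
    qed
    moreover have "0 \<le> B" using N by (simp add: B_def)
    ultimately show ?thesis by blast
  qed
  obtain p q r s where "p \<in> positive_cone" "q \<in> positive_cone" "r \<in> positive_cone"
    "s \<in> positive_cone" "x = (p + (-1) *\<^sub>C q) + (\<i> *\<^sub>C r + (- \<i>) *\<^sub>C s)"
    by (rule positive_cone_decompose)
  then show ?thesis using add scale cone by simp
qed

text \<open>Dividing by \<open>onorm \<phi> * t\<close> puts the pointwise bounds into one family of
  seminorms, whose common constant is the strong Cesaro constant.\<close>

theorem linear_integral_growth_imp_strongly_cesaro:
  assumes "individually_eventually_positive T" "linear_integral_growth"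
  shows "strongly_cesaro_bounded T"
proof -
  define I where "I = (dual_space :: ('a complexification \<Rightarrow> complex) set) \<times> {0::real<..}"
  define p where "p = (\<lambda>(\<phi>, t) x. functional_integral \<phi> t x / (onorm \<phi> * t))"
  note pointwise = functional_integral_pointwise[OF assms]
  have on: "0 \<le> onorm \<phi>" if "\<phi> \<in> dual_space" for \<phi> :: "'a complexification \<Rightarrow> complex"
    using that by (auto simp: dual_space_def onorm_pos_le)
  have "\<exists>C. \<forall>i\<in>I. \<forall>x. p i x \<le> C * norm x"
  proof (rule uniform_boundedness_seminorms)
    fix i assume "i \<in> I"
    then obtain \<phi> t where i: "i = (\<phi>, t)" and \<phi>: "\<phi> \<in> dual_space" and t: "0 < t"
      by (auto simp: I_def)
    show "continuous_on UNIV (p i)"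
      unfolding p_def i prod.case divide_inverse
      using t by (intro continuous_on_mult_right functional_integral_continuous \<phi>) auto
    show "p i (x + y) \<le> p i x + p i y" for x y
      using divide_right_mono[OF functional_integral_add[OF \<phi>, of t x y], of "onorm \<phi> * t"] on[OF \<phi>] t
      by (simp add: p_def i add_divide_distrib)
    show "p i (r *\<^sub>R x) = \<bar>r\<bar> * p i x" for r x
      using functional_integral_scaleC[OF \<phi>, of t "complex_of_real r" x]
      by (simp add: p_def i scaleC_of_real)
  next
    fix x
    obtain M where M: "0 \<le> M"
      "\<And>\<phi> t. \<phi> \<in> dual_space \<Longrightarrow> 0 \<le> t \<Longrightarrow> functional_integral \<phi> t x \<le> M * onorm \<phi> * t"
      using pointwise by blast
    have "functional_integral \<phi> t x / (onorm \<phi> * t) \<le> M" if "\<phi> \<in> dual_space" "0 < t" for \<phi> t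
    \<comment> \<open>When \<open>onorm \<phi> = 0\<close> the quotient is 0 by the convention on
      division.\<close>
    proof (cases "onorm \<phi> = 0")
      case False
      then show ?thesis using M(2)[of \<phi> t] that on[OF that(1)] by (simp add: divide_le_eq mult.assoc)
    qed (use M in simp)
    then show "\<exists>M. \<forall>i\<in>I. p i x \<le> M" by (auto simp: I_def p_def)
  qed
  then obtain C where C: "\<And>\<phi> t x. \<phi> \<in> dual_space \<Longrightarrow> 0 < t \<Longrightarrow>
      functional_integral \<phi> t x / (onorm \<phi> * t) \<le> C * norm x"
    by (fastforce simp: I_def p_def)
  have "(1 / t) * functional_integral \<phi> t x \<le> C * norm x * onorm \<phi>"
    if \<phi>: "\<phi> \<in> dual_space" and t: "0 < t" for \<phi> t x
  \<comment> \<open>The normalised seminorm carries no information when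
    \<open>onorm \<phi> = 0\<close>; the pointwise bound then gives the claim.\<close>
  proof (cases "onorm \<phi> = 0")
    case True
    obtain M where "functional_integral \<phi> t x \<le> M * onorm \<phi> * t"
      using pointwise[of x] \<phi> t by (meson less_imp_le)
    then show ?thesis using True t by (simp add: divide_le_0_iff)
  next
    case False
    then show ?thesis using C[OF that, of x] on[OF \<phi>] t by (simp add: field_simps)
  qed
  then show ?thesis
    unfolding strongly_cesaro_bounded_def functional_integral_def by blast
qed

text \<open>A functional norming the weighted integral is moved under the integral sign. It depends
  on \<open>w\<close>, \<open>t\<close> and \<open>x\<close>, so it is paired with bounds uniform
  over functionals.\<close>

lemma norm_weighted_orbit_integral_le:
  assumes w: "continuous_on {0..t} w"
  obtains \<phi> where "\<phi> \<in> dual_space" "onorm \<phi> \<le> 2"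
    "norm (integral {0..t} (\<lambda>s. w s *\<^sub>C T s x)) \<le> integral {0..t} (\<lambda>s. cmod (w s) * cmod (\<phi> (T s x)))"
proof -
  let ?y = "integral {0..t} (\<lambda>s. w s *\<^sub>C T s x)"
  obtain \<phi> where \<phi>: "\<phi> \<in> dual_space" "onorm \<phi> \<le> 2" and norming: "norm ?y \<le> cmod (\<phi> ?y)"
    by (rule dual_space_norming)
  have lin: "bounded_linear \<phi>" and hom: "\<And>c x. \<phi> (c *\<^sub>C x) = c * \<phi> x"
    using \<phi>(1) by (auto simp: dual_space_def)
  have "\<phi> ?y = integral {0..t} (\<phi> \<circ> (\<lambda>s. w s *\<^sub>C T s x))"
    by (intro integral_linear[symmetric] lin integrable_continuous_real
        bounded_bilinear.continuous_on[OF bounded_bilinear_scaleC] w orbit_continuous_Icc) simp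
  also have "cmod \<dots> \<le> integral {0..t} (\<lambda>s. cmod (w s) * cmod (\<phi> (T s x)))"
  proof (rule integral_norm_bound_integral)
    show "\<phi> \<circ> (\<lambda>s. w s *\<^sub>C T s x) integrable_on {0..t}"
      by (intro integrable_linear lin integrable_continuous_real
        bounded_bilinear.continuous_on[OF bounded_bilinear_scaleC] w orbit_continuous_Icc) simp
    show "(\<lambda>s. cmod (w s) * cmod (\<phi> (T s x))) integrable_on {0..t}"
      by (intro integrable_continuous_real continuous_intros w functional_orbit_continuous \<phi>(1)) simp
  qed (simp add: hom norm_mult)
  finally show thesis using that[OF \<phi>] norming by linarith
qed

lemma strongly_cesaro_functional_integral:
  assumes "strongly_cesaro_bounded T"
  obtains C where "0 \<le> C"
    "\<And>\<phi> t x. \<phi> \<in> dual_space \<Longrightarrow> onorm \<phi> \<le> 2 \<Longrightarrow> 0 \<le> t \<Longrightarrow> functional_integral \<phi> t x \<le> C * norm x * t"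
proof -
  obtain C where C: "\<And>\<phi> t x. \<phi> \<in> dual_space \<Longrightarrow> 0 < t \<Longrightarrow>
      (1 / t) * functional_integral \<phi> t x \<le> C * norm x * onorm \<phi>"
    using assms unfolding strongly_cesaro_bounded_def functional_integral_def by blast
  define B where "B = 2 * max C 0"
  show thesis
  proof (rule that)
    show "0 \<le> B" by (simp add: B_def)
    fix \<phi> :: "'a complexification \<Rightarrow> complex" and t :: real and x
    assume \<phi>: "\<phi> \<in> dual_space" "onorm \<phi> \<le> 2" and t: "0 \<le> t"
    have on: "0 \<le> onorm \<phi>" using \<phi> by (auto simp: dual_space_def onorm_pos_le)
    show "functional_integral \<phi> t x \<le> B * norm x * t"
    proof (cases "t = 0")
      case True
      then show ?thesis by (simp add: functional_integral_def)
    next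
      case False
      then have "functional_integral \<phi> t x \<le> C * norm x * onorm \<phi> * t"
        using C[OF \<phi>(1), of t x] t by (simp add: field_simps)
      also have "\<dots> \<le> max C 0 * norm x * onorm \<phi> * t"
        using on t by (intro mult_right_mono) auto
      also have "\<dots> \<le> max C 0 * norm x * 2 * t"
        using \<phi>(2) t by (intro mult_right_mono mult_left_mono) auto
      finally show ?thesis by (simp add: B_def mult.commute mult.left_commute)
    qed
  qed
qed

theorem strongly_cesaro_imp_cesaro:
  assumes "strongly_cesaro_bounded T"
  shows "cesaro_bounded T"
proof -
  obtain C where "0 \<le> C" and C: "\<And>\<phi> t x. \<phi> \<in> dual_space \<Longrightarrow> onorm \<phi> \<le> 2 \<Longrightarrow> 0 \<le> t \<Longrightarrow>
      functional_integral \<phi> t x \<le> C * norm x * t"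
    using strongly_cesaro_functional_integral[OF assms] by blast
  have "(1 / t) * norm (integral {0..t} (\<lambda>s. T s x)) \<le> C * norm x" if t: "0 < t" for t x
  proof -
    have "continuous_on {0..t} (\<lambda>_. 1 :: complex)" by (rule continuous_on_const)
    from norm_weighted_orbit_integral_le[OF this, of x]
    obtain \<phi> where \<phi>: "\<phi> \<in> dual_space" "onorm \<phi> \<le> 2"
      and "norm (integral {0..t} (\<lambda>s. T s x)) \<le> functional_integral \<phi> t x"
      unfolding functional_integral_def by auto
    note this(3)
    also have "\<dots> \<le> C * norm x * t" using t by (intro C \<phi>) auto
    finally show ?thesis using t by (simp add: field_simps)
  qed
  then show ?thesis unfolding cesaro_bounded_def by blast
qed

theorem strongly_cesaro_imp_uniformly_kreiss:
  assumes "strongly_cesaro_bounded T"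
  shows "uniformly_kreiss_bounded T"
proof -
  obtain C where C0: "0 \<le> C" and C: "\<And>\<phi> t x. \<phi> \<in> dual_space \<Longrightarrow> onorm \<phi> \<le> 2 \<Longrightarrow> 0 \<le> t \<Longrightarrow>
      functional_integral \<phi> t x \<le> C * norm x * t"
    using strongly_cesaro_functional_integral[OF assms] by blast
  have "norm (integral {0..t} (\<lambda>s. exp (\<i> * complex_of_real (\<beta> * s)) *\<^sub>C exp (- \<alpha> * s) *\<^sub>R T s x))
      \<le> C * norm x / \<alpha>" if \<alpha>: "0 < \<alpha>" and t: "0 < t" for \<alpha> \<beta> t x
  proof -
    \<comment> \<open>The phase has modulus 1, so \<beta> disappears once absolute values are taken
      and only the decay rate \<alpha> remains.\<close>
    define w where "w s = exp (\<i> * complex_of_real (\<beta> * s)) * complex_of_real (exp (- \<alpha> * s))" for s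
    have cmod_w: "cmod (w s) = exp (- \<alpha> * s)" for s
      by (simp add: w_def norm_mult)
    have "continuous_on {0..t} w" unfolding w_def by (intro continuous_intros)
    then obtain \<phi> where \<phi>: "\<phi> \<in> dual_space" "onorm \<phi> \<le> 2"
      "norm (integral {0..t} (\<lambda>s. w s *\<^sub>C T s x)) \<le> integral {0..t} (\<lambda>s. cmod (w s) * cmod (\<phi> (T s x)))"
      by (rule norm_weighted_orbit_integral_le)
    note \<phi>(3)
    also have "integral {0..t} (\<lambda>s. cmod (w s) * cmod (\<phi> (T s x))) \<le> C * norm x / \<alpha>"
      unfolding cmod_w
    proof (rule integral_exp_weight_le)
      show "continuous_on {0..t} (\<lambda>s. cmod (\<phi> (T s x)))"
        by (intro continuous_on_norm functional_orbit_continuous \<phi> order_refl)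
      show "integral {0..s} (\<lambda>s. cmod (\<phi> (T s x))) \<le> C * norm x * s" if "s \<in> {0..t}" for s
        using C[OF \<phi>(1,2), of s x] that by (simp add: functional_integral_def)
    qed (use \<alpha> t C0 in auto)
    finally show ?thesis by (simp only: w_def scaleC_scaleR)
  qed
  then show ?thesis unfolding uniformly_kreiss_bounded_def by blast
qed

end

theorem proposition2p6:
  fixes T :: "real \<Rightarrow> 'a::banach_lattice complexification \<Rightarrow> 'a complexification"
  assumes "C0_semigroup T"
    and "individually_eventually_positive T"
  shows "(cesaro_bounded T \<longleftrightarrow> strongly_cesaro_bounded T) \<and>
         (strongly_cesaro_bounded T \<longleftrightarrow> uniformly_kreiss_bounded T) \<and>
         (uniformly_kreiss_bounded T \<longleftrightarrow> kreiss_bounded T) \<and>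
         (kreiss_bounded T \<longleftrightarrow> abel_bounded T)"
proof -
  interpret c0_semigroup T by standard (rule assms(1))
  \<comment> \<open>Cesaro and Abel boundedness both give linear growth, hence the strong Cesaro
    bound; this returns to Cesaro boundedness and leads through the two Kreiss bounds to the Abel
    bound.\<close>
  show ?thesis
    using cesaro_imp_linear_integral_growth abel_imp_linear_integral_growth
      linear_integral_growth_imp_strongly_cesaro[OF assms(2)] strongly_cesaro_imp_cesaro
      strongly_cesaro_imp_uniformly_kreiss uniformly_kreiss_imp_kreiss kreiss_imp_abel
    by blast
qed

end
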